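(* Let $n\geq 3$ be an integer, $G=SL(n,\mathbf{Z})$, and let $S=S^{-1}\subset G$ be a finite symmetric generating set. For $w=(s_1,\ldots,s_N)\in S^N$ put $g_w=s_1\cdots s_N\in G$. Then there exists $\beta>0$ such that for all $N\geq 1$, $$|\{w\in S^N \mid \text{some entry of the matrix } g_w \text{ is the square of an integer}\}|\ll |S|^{N(1-\beta)},$$ where $\beta$ and the implied constant depend only on $n$ and $S$. Equivalently, if $(X_k)$ is the simple left-invariant random walk on $G$ ($X_0=1$, $X_{k+1}=X_k\xi_{k+1}$ with $(\xi_k)$ independent and uniformly distributed on $S$), then $\mathbf{P}(\text{some entry of } X_k \text{ is a square})\ll \exp(-\delta k)$ for $k\geq 1$, for some $\delta>0$, where $\delta$ and the implied constant depend only on $n$ and $S$. *)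

theory Defs
  imports "HOL-Analysis.Analysis"
begin

text \<open>The special linear group SL(n,Z), with n = CARD('n).\<close>
definition SL_int :: "(int^'n^'n) set" where
  "SL_int = {A. det A = 1}"

text \<open>Product g_w = s_1 s_2 ... s_N of a word w = [s_1,...,s_N].\<close>
definition word_prod :: "(int^'n^'n) list \<Rightarrow> int^'n^'n" where
  "word_prod w = foldr (**) w (mat 1)"

text \<open>Subgroup of SL(n,Z) generated by S: smallest set containing 1 and S,
  closed under products and inverses (inverse of a in SL(n,Z) is the b with a b = 1).\<close>
inductive_set gen_subgroup :: "(int^'n^'n) set \<Rightarrow> (int^'n^'n) set" for S where
  gen_one: "mat 1 \<in> gen_subgroup S"
| gen_base: "s \<in> S \<Longrightarrow> s \<in> gen_subgroup S"
| gen_mult: "a \<in> gen_subgroup S \<Longrightarrow> b \<in> gen_subgroup S \<Longrightarrow> a ** b \<in> gen_subgroup S"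
| gen_inv: "a \<in> gen_subgroup S \<Longrightarrow> a ** b = mat 1 \<Longrightarrow> b \<in> gen_subgroup S"

text \<open>S = S^{-1}: the inverse of every element of S lies in S.\<close>
definition symmetric_set :: "(int^'n^'n) set \<Rightarrow> bool" where
  "symmetric_set S \<longleftrightarrow> (\<forall>s\<in>S. \<exists>t\<in>S. s ** t = mat 1)"

definition is_int_square :: "int \<Rightarrow> bool" where
  "is_int_square x \<longleftrightarrow> (\<exists>m::int. x = m ^ 2)"

end

theory Submission
  imports Defs "HOL-Computational_Algebra.Primes" "HOL-Number_Theory.Cong" "HOL-Real_Asymp.Real_Asymp"
begin

text \<open>
  The proof is a second moment sieve fed by a uniform spectral gap. For distinct odd primes \<open>p\<close>, \<open>q\<close> the walk
  equidistributes exponentially fast in \<open>SL(n, Z/pq)\<close>, at a rate independent of \<open>p\<close> and \<open>q\<close>: a function that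
  is almost invariant under the generators is almost invariant under every elementary matrix
  (relative property (T) of \<open>Z\<^sup>2\<close> in the affine group, by Fourier analysis and a ping-pong of shears on the
  dual group), hence under the whole group, since every element is a product of a bounded number of elementary
  matrices. Let \<open>h\<^sub>p(a)\<close> be \<open>1\<close> or \<open>-1\<close> according as \<open>a\<close> is or is not a square mod \<open>p\<close>. Row operations show
  that \<open>h\<^sub>p h\<^sub>q\<close> of a fixed entry has mean at most \<open>n/p\<close>, so that the sum of \<open>h\<^sub>p\<close> over the primes
  \<open>K < p \<le> K\<^sup>2\<close> is typically much smaller than the number of these primes, the value it takes on squares.
  It remains to let \<open>K\<close> grow as a small exponential in the length of the walk.
\<close>

section \<open>Relative property (T) for the affine group of the plane over a finite ring\<close>

text \<open>Opening the square of a sum over primes brings in pairs, so the gap must hold modulo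
  \<open>p * q\<close> with constants blind to both primes. Two inputs ensure this: the ping-pong
  takes place in \<open>Z^2\<close>, away from wrap-around, and yields an absolute constant; the
  elimination uses a number of operations depending on \<open>n\<close> only. A third index,
  available as \<open>n >= 3\<close>, places every \<open>elem a c t\<close> in a copy of
  \<open>Z^2\<close> on which shears act. Near invariance under the whole group is then incompatible
  with mean zero, because a mean-zero function has mean square displacement exactly twice its
  squared norm. The size of the group enters once, when an \<open>L2\<close> estimate is evaluated
  at the identity: it costs a factor \<open>(p q)^(n^2/2)\<close>, at most \<open>K^(2 n^2)\<close>
  for primes up to \<open>K^2\<close>. A power of \<open>K\<close> is affordable against exponential
  decay, so the wide window from \<open>K\<close> to \<open>K^2\<close> and an elementary lower
  bound for the number of primes are enough. The lower end \<open>K\<close> makes the correlations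
  \<open>O(1/K)\<close>, and having at least \<open>K\<close> primes makes the diagonal
  \<open>O(1/K)\<close> too.\<close>

definition root_char :: "int \<Rightarrow> int \<Rightarrow> complex" where
  "root_char m k = cis (2 * pi * of_int k / of_int m)"

lemma root_char_add: "root_char m (a + b) = root_char m a * root_char m b"
  by (simp add: root_char_def cis_mult distrib_left add_divide_distrib)

lemma root_char_zero [simp]: "root_char m 0 = 1"
  by (simp add: root_char_def)

lemma root_char_mult_self [simp]: "m \<noteq> 0 \<Longrightarrow> root_char m (m * b) = 1"
  using cis_multiple_2pi[of "of_int b"] by (simp add: root_char_def mult.assoc)

lemma root_char_period: "m \<noteq> 0 \<Longrightarrow> root_char m (a + b * m) = root_char m a"
  by (simp add: root_char_add mult.commute[of b])

lemma norm_root_char [simp]: "norm (root_char m a) = 1"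
  by (simp add: root_char_def)

lemma cnj_root_char: "cnj (root_char m a) = root_char m (- a)"
  by (simp add: root_char_def cis_cnj)

lemma root_char_ne_1:
  assumes "\<bar>d\<bar> < m" "d \<noteq> 0" shows "root_char m d \<noteq> 1"
proof
  assume "root_char m d = 1"
  then have "cos (2 * pi * of_int d / of_int m) = 1"
    by (simp add: root_char_def complex_eq_iff)
  then obtain n :: int where "2 * pi * of_int d / of_int m = n * (2 * pi)"
    by (auto simp: cos_one_2pi_int)
  moreover have "m > 0" using assms by linarith
  ultimately have "pi * real_of_int d = pi * real_of_int (n * m)"
    by (simp add: field_simps)
  then have "real_of_int d = real_of_int (n * m)" by simp
  then have "d = n * m" by (simp only: of_int_eq_iff)
  with assms show False
    by (metis abs_of_nonneg dvd_imp_le_int dvd_triv_right not_less abs_ge_zero order_less_le_trans order_le_less_trans abs_ge_self)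
qed

text \<open>The angle \<open>2 pi |j| / (2h+1)\<close> lies between \<open>pi/2\<close> and
  \<open>pi\<close>, so its cosine is at most 0 and the squared distance \<open>2 - 2 cos\<close> to
  1 is at least 2. Hence translations move every frequency outside the half-size box.\<close>

lemma root_char_far:
  assumes "h \<ge> 0" "\<bar>j\<bar> \<le> h" "h < 2 * \<bar>j\<bar>"
  shows "2 \<le> (norm (root_char (2 * h + 1) j - 1))\<^sup>2"
proof -
  let ?x = "2 * pi * real_of_int j / real_of_int (2 * h + 1)"
  let ?y = "2 * pi * real_of_int \<bar>j\<bar> / real_of_int (2 * h + 1)"
  have "cos ?x = cos \<bar>?x\<bar>" by (simp add: abs_if)
  also have "\<bar>?x\<bar> = ?y" using assms(1) by (simp add: abs_mult)
  finally have 1: "cos ?x = cos ?y" .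
  have a: "pi / 2 \<le> ?y"
  proof -
    have "real_of_int (2 * h + 1) \<le> real_of_int (4 * \<bar>j\<bar>)"
      using assms by (simp only: of_int_le_iff) 
    then have "pi * real_of_int (2 * h + 1) \<le> pi * real_of_int (4 * \<bar>j\<bar>)"
      by (intro mult_left_mono) auto
    then show ?thesis using assms(1) by (simp add: field_simps)
  qed
  have b: "?y \<le> pi"
  proof -
    have "real_of_int (2 * \<bar>j\<bar>) \<le> real_of_int (2 * h + 1)"
      using assms by (simp only: of_int_le_iff) 
    then have "pi * real_of_int (2 * \<bar>j\<bar>) \<le> pi * real_of_int (2 * h + 1)"
      by (intro mult_left_mono) auto
    then show ?thesis using assms(1) by (simp add: field_simps)
  qed
  have "cos ?y \<le> cos (pi / 2)"
    using a b by (intro cos_monotone_0_pi_le) auto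
  with 1 have c: "cos ?x \<le> 0" by simp
  have "(norm (root_char (2 * h + 1) j - 1))\<^sup>2 = (cos ?x - 1)\<^sup>2 + (sin ?x)\<^sup>2"
    by (simp add: root_char_def cmod_power2)
  also have "\<dots> = 2 - 2 * cos ?x"
    by (simp add: power2_diff sin_squared_eq)
  finally show ?thesis using c by simp
qed

text \<open>The window \<open>{-h..h}\<close> is one full period, and a unit shift only trades one
  endpoint for the other. The odd modulus is written \<open>2h+1\<close> to have symmetric
  representatives, whose absolute values the ping-pong on the dual torus compares.\<close>

lemma sum_shift_period:
  fixes \<phi> :: "int \<Rightarrow> 'a::comm_monoid_add"
  assumes h: "h \<ge> 0" and per: "\<And>s. \<phi> (s + (2 * h + 1)) = \<phi> s"
  shows "(\<Sum>s\<in>{-h..h}. \<phi> (s + a)) = (\<Sum>s\<in>{-h..h}. \<phi> s)"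
proof -
  have step: "(\<Sum>s\<in>{-h..h}. \<psi> (s + 1)) = (\<Sum>s\<in>{-h..h}. \<psi> s)"
    if per: "\<And>s. \<psi> (s + (2 * h + 1)) = \<psi> s" for \<psi> :: "int \<Rightarrow> 'a"
  proof -
    have "(\<Sum>s\<in>{-h..h}. \<psi> (s + 1)) = (\<Sum>s\<in>{-h+1..h+1}. \<psi> s)"
      by (rule sum.reindex_bij_witness[where i = "\<lambda>s. s - 1" and j = "\<lambda>s. s + 1"]) auto
    also have "{-h+1..h+1} = insert (h + 1) {-h+1..h}" using h by auto
    also have "sum \<psi> \<dots> = \<psi> (h + 1) + sum \<psi> {-h+1..h}" by simp
    also have "\<psi> (h + 1) = \<psi> (- h)" using per[of "-h"] by (simp add: algebra_simps)
    also have "\<psi> (-h) + sum \<psi> {-h+1..h} = sum \<psi> (insert (-h) {-h+1..h})" by simp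
    also have "insert (-h) {-h+1..h} = {-h..h}" using h by auto
    finally show ?thesis .
  qed
  show ?thesis
  proof (induction a rule: int_induct[where k = 0])
    case base show ?case by simp
  next
    case (step1 i)
    have "(\<Sum>s\<in>{-h..h}. \<phi> (s + 1 + i)) = (\<Sum>s\<in>{-h..h}. \<phi> (s + i))"
      by (rule step[where \<psi> = "\<lambda>s. \<phi> (s + i)"]) (metis per add.assoc add.commute)
    with step1 show ?case by (simp add: algebra_simps)
  next
    case (step2 i)
    have "(\<Sum>s\<in>{-h..h}. \<phi> (s + 1 + (i - 1))) = (\<Sum>s\<in>{-h..h}. \<phi> (s + (i - 1)))"
      by (rule step[where \<psi> = "\<lambda>s. \<phi> (s + (i - 1))"]) (metis per add.assoc add.commute)
    with step2 show ?case by (simp add: algebra_simps)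
  qed
qed

lemma root_char_orthogonal:
  assumes h: "h \<ge> 0" and d: "\<bar>d\<bar> < 2 * h + 1"
  shows "(\<Sum>j\<in>{-h..h}. root_char (2 * h + 1) (j * d)) = (if d = 0 then of_int (2 * h + 1) else 0)"
proof (cases "d = 0")
  case True then show ?thesis using h by simp
next
  case False
  let ?e = "root_char (2 * h + 1)"
  have per: "?e ((s + (2 * h + 1)) * d) = ?e (s * d)" for s
    using root_char_period[of "2 * h + 1" "s * d" d] h by (simp add: algebra_simps)
  have "(\<Sum>j\<in>{-h..h}. ?e ((j + 1) * d)) = (\<Sum>j\<in>{-h..h}. ?e (j * d))"
    by (rule sum_shift_period[OF h, where \<phi> = "\<lambda>j. ?e (j * d)"]) (rule per)
  then have "?e d * (\<Sum>j\<in>{-h..h}. ?e (j * d)) = (\<Sum>j\<in>{-h..h}. ?e (j * d))"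
    by (simp add: root_char_add[symmetric] sum_distrib_left algebra_simps)
  then have "(?e d - 1) * (\<Sum>j\<in>{-h..h}. ?e (j * d)) = 0" by (simp add: algebra_simps)
  with root_char_ne_1[OF d False] False show ?thesis by simp
qed

lemma sum_rotate3:
  "(\<Sum>x\<in>X. \<Sum>j\<in>A. \<Sum>k\<in>B. g j k x) = (\<Sum>j\<in>A. \<Sum>k\<in>B. \<Sum>x\<in>X. g j k x)"
proof -
  have "(\<Sum>x\<in>X. \<Sum>j\<in>A. \<Sum>k\<in>B. g j k x) = (\<Sum>j\<in>A. \<Sum>x\<in>X. \<Sum>k\<in>B. g j k x)" by (rule sum.swap)
  also have "\<dots> = (\<Sum>j\<in>A. \<Sum>k\<in>B. \<Sum>x\<in>X. g j k x)" by (intro sum.cong refl sum.swap)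
  finally show ?thesis .
qed

lemma parseval:
  assumes h: "h \<ge> 0"
  shows "(\<Sum>j\<in>{-h..h}. (norm (\<Sum>s\<in>{-h..h}. root_char (2 * h + 1) (j * s) * \<phi> s))\<^sup>2)
    = of_int (2 * h + 1) * (\<Sum>s\<in>{-h..h}. (norm (\<phi> s))\<^sup>2)"
proof -
  let ?e = "root_char (2 * h + 1)" and ?H = "{-h..h}"
  have "complex_of_real (\<Sum>j\<in>?H. (norm (\<Sum>s\<in>?H. ?e (j * s) * \<phi> s))\<^sup>2)
     = (\<Sum>j\<in>?H. (\<Sum>s\<in>?H. ?e (j * s) * \<phi> s) * cnj (\<Sum>s\<in>?H. ?e (j * s) * \<phi> s))"
    by (simp only: of_real_sum complex_norm_square)
  also have "\<dots> = (\<Sum>j\<in>?H. \<Sum>s\<in>?H. \<Sum>r\<in>?H. ?e (j * (s - r)) * (\<phi> s * cnj (\<phi> r)))"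
    unfolding cnj_sum sum_product
    by (intro sum.cong refl) (simp add: cnj_root_char root_char_add[symmetric] algebra_simps)
  also have "\<dots> = (\<Sum>s\<in>?H. \<Sum>r\<in>?H. (\<Sum>j\<in>?H. ?e (j * (s - r))) * (\<phi> s * cnj (\<phi> r)))"
    unfolding sum_distrib_right by (rule sum_rotate3)
  also have "\<dots> = (\<Sum>s\<in>?H. \<Sum>r\<in>?H. if s = r then of_int (2 * h + 1) * (\<phi> s * cnj (\<phi> r)) else 0)"
    using h by (intro sum.cong refl) (subst root_char_orthogonal, auto)
  also have "\<dots> = of_int (2 * h + 1) * (\<Sum>s\<in>?H. \<phi> s * cnj (\<phi> s))"
    by (simp add: sum_distrib_left)
  also have "\<dots> = complex_of_real (of_int (2 * h + 1) * (\<Sum>s\<in>?H. (norm (\<phi> s))\<^sup>2))"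
    by (simp only: of_real_mult of_real_sum complex_norm_square of_real_of_int_eq)
  finally show ?thesis by (simp only: of_real_eq_iff)
qed

section \<open>Spectral measures for an action of the square of a cyclic group of odd order\<close>

locale torus_action =
  fixes X :: "'x set" and h :: int and T :: "int \<Rightarrow> int \<Rightarrow> 'x \<Rightarrow> 'x"
  assumes finite_X: "finite X" and h_nonneg: "h \<ge> 0"
    and bij_T: "bij_betw (T s t) X X"
    and T_add: "x \<in> X \<Longrightarrow> T s t (T s' t' x) = T (s + s') (t + t') x"
    and T_per1: "x \<in> X \<Longrightarrow> T (s + (2 * h + 1)) t x = T s t x"
    and T_per2: "x \<in> X \<Longrightarrow> T s (t + (2 * h + 1)) x = T s t x"
begin

abbreviation e :: "int \<Rightarrow> complex" where "e \<equiv> root_char (2 * h + 1)"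

text \<open>Up to the factor \<open>(2h+1)^2\<close> this is the projection of \<open>f\<close> to
  one isotypic component of the translation action, evaluated at \<open>x\<close>.\<close>

definition fc :: "('x \<Rightarrow> complex) \<Rightarrow> int \<Rightarrow> int \<Rightarrow> 'x \<Rightarrow> complex" where
  "fc f j k x = (\<Sum>s\<in>{-h..h}. \<Sum>t\<in>{-h..h}. e (j * s + k * t) * f (T s t x))"

text \<open>The spectral measure of \<open>f\<close> on the dual torus, scaled by \<open>(2h+1)^4\<close>.\<close>
definition spec :: "('x \<Rightarrow> complex) \<Rightarrow> int \<Rightarrow> int \<Rightarrow> real" where
  "spec f j k = (\<Sum>x\<in>X. (norm (fc f j k x))\<^sup>2)"

definition nsq :: "('x \<Rightarrow> complex) \<Rightarrow> real" where
  "nsq f = (\<Sum>x\<in>X. (norm (f x))\<^sup>2)"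

lemma spec_nonneg: "spec f j k \<ge> 0"
  by (auto simp: spec_def intro: sum_nonneg)

lemma char_T_per1: "x \<in> X \<Longrightarrow> e (j * (s + (2 * h + 1)) + c) * f (T (s + (2 * h + 1)) t x) = e (j * s + c) * f (T s t x)"
  using root_char_period[of "2 * h + 1" "j * s + c" j] h_nonneg by (simp only: T_per1) (simp add: algebra_simps)

lemma char_T_per2: "x \<in> X \<Longrightarrow> e (c + k * (t + (2 * h + 1))) * f (T s (t + (2 * h + 1)) x) = e (c + k * t) * f (T s t x)"
  using root_char_period[of "2 * h + 1" "c + k * t" k] h_nonneg by (simp only: T_per2) (simp add: algebra_simps)

lemma sum_shift2:
  fixes \<phi> :: "int \<Rightarrow> int \<Rightarrow> complex"
  assumes "\<And>s t. \<phi> (s + (2 * h + 1)) t = \<phi> s t" "\<And>s t. \<phi> s (t + (2 * h + 1)) = \<phi> s t"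
  shows "(\<Sum>s\<in>{-h..h}. \<Sum>t\<in>{-h..h}. \<phi> (s + a) (t + b)) = (\<Sum>s\<in>{-h..h}. \<Sum>t\<in>{-h..h}. \<phi> s t)"
proof -
  have "(\<Sum>s\<in>{-h..h}. \<Sum>t\<in>{-h..h}. \<phi> (s + a) (t + b)) = (\<Sum>s\<in>{-h..h}. \<Sum>t\<in>{-h..h}. \<phi> (s + a) t)"
    by (intro sum.cong refl sum_shift_period h_nonneg assms)
  also have "\<dots> = (\<Sum>s\<in>{-h..h}. \<Sum>t\<in>{-h..h}. \<phi> s t)"
    by (rule sum_shift_period[where \<phi> = "\<lambda>s. \<Sum>t\<in>{-h..h}. \<phi> s t"]) (simp_all add: h_nonneg assms)
  finally show ?thesis .
qed

text \<open>Parseval in each variable, along the orbit of a fixed \<open>x\<close>, gives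
  \<open>(2h+1)^2\<close> times a sum over all translates; as translations permute \<open>X\<close>,
  summing over \<open>x\<close> turns each of the \<open>(2h+1)^2\<close> translates into
  \<open>nsq f\<close>.\<close>

lemma parseval2: "(\<Sum>j\<in>{-h..h}. \<Sum>k\<in>{-h..h}. spec f j k) = of_int (2 * h + 1) ^ 4 * nsq f"
proof -
  let ?H = "{-h..h}" and ?m = "real_of_int (2 * h + 1)"
  have x: "(\<Sum>j\<in>?H. \<Sum>k\<in>?H. (norm (fc f j k x))\<^sup>2) = ?m\<^sup>2 * (\<Sum>s\<in>?H. \<Sum>t\<in>?H. (norm (f (T s t x)))\<^sup>2)" for x
  proof -
    have "(\<Sum>j\<in>?H. \<Sum>k\<in>?H. (norm (fc f j k x))\<^sup>2)
      = (\<Sum>k\<in>?H. \<Sum>j\<in>?H. (norm (\<Sum>s\<in>?H. e (j * s) * (\<Sum>t\<in>?H. e (k * t) * f (T s t x))))\<^sup>2)"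
      by (subst sum.swap) (simp add: fc_def root_char_add sum_distrib_left mult.assoc)
    also have "\<dots> = (\<Sum>k\<in>?H. ?m * (\<Sum>s\<in>?H. (norm (\<Sum>t\<in>?H. e (k * t) * f (T s t x)))\<^sup>2))"
      by (simp only: parseval[OF h_nonneg])
    also have "\<dots> = ?m * (\<Sum>s\<in>?H. \<Sum>k\<in>?H. (norm (\<Sum>t\<in>?H. e (k * t) * f (T s t x)))\<^sup>2)"
      unfolding sum_distrib_left[symmetric] by (subst sum.swap) (rule refl)
    also have "\<dots> = ?m * (\<Sum>s\<in>?H. ?m * (\<Sum>t\<in>?H. (norm (f (T s t x)))\<^sup>2))"
      by (simp only: parseval[OF h_nonneg])
    also have "\<dots> = ?m\<^sup>2 * (\<Sum>s\<in>?H. \<Sum>t\<in>?H. (norm (f (T s t x)))\<^sup>2)"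
      unfolding sum_distrib_left[symmetric] by (simp only: power2_eq_square mult.assoc)
    finally show ?thesis .
  qed
  have "(\<Sum>j\<in>?H. \<Sum>k\<in>?H. spec f j k) = (\<Sum>x\<in>X. \<Sum>j\<in>?H. \<Sum>k\<in>?H. (norm (fc f j k x))\<^sup>2)"
    unfolding spec_def by (rule sum_rotate3[symmetric])
  also have "\<dots> = ?m\<^sup>2 * (\<Sum>s\<in>?H. \<Sum>t\<in>?H. \<Sum>x\<in>X. (norm (f (T s t x)))\<^sup>2)"
    unfolding x sum_distrib_left[symmetric] by (subst sum_rotate3) (rule refl)
  also have "\<dots> = ?m\<^sup>2 * (\<Sum>s\<in>?H. \<Sum>t\<in>?H. nsq f)"
    unfolding nsq_def by (simp only: sum.reindex_bij_betw[OF bij_T, where g = "\<lambda>x. (norm (f x))\<^sup>2"])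
  also have "real (card ?H) = ?m" using h_nonneg by simp
  then have "?m\<^sup>2 * (\<Sum>s\<in>?H. \<Sum>t\<in>?H. nsq f) = ?m ^ 4 * nsq f"
    by (simp only: sum_constant power2_eq_square power4_eq_xxxx mult.assoc)
  finally show ?thesis .
qed

lemma spec_sum_le:
  assumes "A \<subseteq> {-h..h} \<times> {-h..h}"
  shows "(\<Sum>(j,k)\<in>A. spec f j k) \<le> of_int (2 * h + 1) ^ 4 * nsq f"
proof -
  have "(\<Sum>(j,k)\<in>A. spec f j k) \<le> (\<Sum>(j,k)\<in>{-h..h} \<times> {-h..h}. spec f j k)"
    by (rule sum_mono2) (use assms in \<open>auto simp: spec_nonneg\<close>)
  then show ?thesis by (simp add: sum.cartesian_product[symmetric] parseval2)
qed

text \<open>From \<open>(a + b)^2 <= 3/2 a^2 + 3 b^2\<close>, which is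
  \<open>(a - 2b)^2 >= 0\<close>. The leading factor must stay below 2, the gain of the ping-pong
  from two disjoint images.\<close>

lemma spec_triangle: "spec f j k \<le> 3/2 * spec g j k + 3 * spec (\<lambda>x. f x - g x) j k"
proof -
  have *: "(norm z)\<^sup>2 \<le> 3/2 * (norm w)\<^sup>2 + 3 * (norm (z - w))\<^sup>2" for z w :: complex
  proof -
    have "norm z \<le> norm w + norm (z - w)" by norm
    then have "(norm z)\<^sup>2 \<le> (norm w + norm (z - w))\<^sup>2" by (intro power_mono) auto
    moreover have "0 \<le> (norm w - 2 * norm (z - w))\<^sup>2" by simp
    ultimately show ?thesis by (simp add: power2_sum power2_diff)
  qed
  have d: "fc (\<lambda>x. f x - g x) j k x = fc f j k x - fc g j k x" for x
    by (simp add: fc_def right_diff_distrib sum_subtractf)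
  show ?thesis unfolding spec_def sum_distrib_left sum.distrib[symmetric] d
    by (intro sum_mono *)
qed

text \<open>Shifting the summation window pulls out a character value, so translations are diagonal
  on frequencies.\<close>

lemma spec_T: "spec (\<lambda>x. f (T a b x) - f x) j k = (norm (e (- (j * a + k * b)) - 1))\<^sup>2 * spec f j k"
proof -
  have "fc (\<lambda>x. f (T a b x) - f x) j k x = (e (- (j * a + k * b)) - 1) * fc f j k x" if x: "x \<in> X" for x
  proof -
    let ?g = "\<lambda>s t. e (j * s + k * t) * f (T s t x)"
    have p1: "?g (s + (2 * h + 1)) t = ?g s t" for s t
      by (rule char_T_per1[OF x])
    have p2: "?g s (t + (2 * h + 1)) = ?g s t" for s t
      by (rule char_T_per2[OF x])
    have "(\<Sum>s\<in>{-h..h}. \<Sum>t\<in>{-h..h}. e (j * s + k * t) * f (T a b (T s t x)))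
      = (\<Sum>s\<in>{-h..h}. \<Sum>t\<in>{-h..h}. e (- (j * a + k * b)) * ?g (s + a) (t + b))"
    proof (intro sum.cong refl)
      fix s t
      have "e (j * s + k * t) = e (- (j * a + k * b)) * e (j * (s + a) + k * (t + b))"
        by (simp add: root_char_add[symmetric] algebra_simps)
      then show "e (j * s + k * t) * f (T a b (T s t x)) = e (- (j * a + k * b)) * ?g (s + a) (t + b)"
        by (simp only: T_add[OF x] mult.assoc add.commute[of a] add.commute[of b])
    qed
    also have "\<dots> = e (- (j * a + k * b)) * (\<Sum>s\<in>{-h..h}. \<Sum>t\<in>{-h..h}. ?g (s + a) (t + b))"
      by (simp add: sum_distrib_left)
    also have "(\<Sum>s\<in>{-h..h}. \<Sum>t\<in>{-h..h}. ?g (s + a) (t + b)) = fc f j k x"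
      unfolding fc_def by (rule sum_shift2) (rule p1 p2)+
    finally show ?thesis by (simp add: fc_def right_diff_distrib sum_subtractf left_diff_distrib)
  qed
  then show ?thesis by (simp add: spec_def norm_mult power_mult_distrib sum_distrib_left)
qed

text \<open>Substituting \<open>s + t\<close> for \<open>s\<close> moves \<open>j * t\<close> into
  the second slot: a shear of the torus acts on frequencies by its inverse transpose.\<close>

lemma spec_shear1:
  assumes bij: "bij_betw u X X" and u: "\<And>s t x. x \<in> X \<Longrightarrow> u (T s t x) = T (s - t) t (u x)"
  shows "spec (\<lambda>x. f (u x)) j k = spec f j (j + k)"
proof -
  have "fc (\<lambda>x. f (u x)) j k x = fc f j (j + k) (u x)" if x: "x \<in> X" for x
  proof -
    have ux: "u x \<in> X" using bij x by (rule bij_betw_apply)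
    have "fc (\<lambda>x. f (u x)) j k x = (\<Sum>t\<in>{-h..h}. \<Sum>s\<in>{-h..h}. e (j * s + k * t) * f (T (s - t) t (u x)))"
      unfolding fc_def by (subst sum.swap) (simp add: u[OF x])
    also have "\<dots> = (\<Sum>t\<in>{-h..h}. \<Sum>s\<in>{-h..h}. e (j * (s + - t) + (j + k) * t) * f (T (s + - t) t (u x)))"
      by (simp add: algebra_simps)
    also have "\<dots> = (\<Sum>t\<in>{-h..h}. \<Sum>s\<in>{-h..h}. e (j * s + (j + k) * t) * f (T s t (u x)))"
    proof (rule sum.cong[OF refl])
      fix t
      show "(\<Sum>s\<in>{-h..h}. e (j * (s + - t) + (j + k) * t) * f (T (s + - t) t (u x)))
        = (\<Sum>s\<in>{-h..h}. e (j * s + (j + k) * t) * f (T s t (u x)))"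
        by (rule sum_shift_period[OF h_nonneg, where \<phi> = "\<lambda>s. e (j * s + (j + k) * t) * f (T s t (u x))"]) (rule char_T_per1[OF ux])
    qed
    also have "\<dots> = fc f j (j + k) (u x)" unfolding fc_def by (rule sum.swap)
    finally show ?thesis .
  qed
  then show ?thesis unfolding spec_def
    using sum.reindex_bij_betw[OF bij, where g = "\<lambda>x. (norm (fc f j (j + k) x))\<^sup>2"] by simp
qed

lemma spec_shear2:
  assumes bij: "bij_betw l X X" and l: "\<And>s t x. x \<in> X \<Longrightarrow> l (T s t x) = T s (t - s) (l x)"
  shows "spec (\<lambda>x. f (l x)) j k = spec f (j + k) k"
proof -
  have "fc (\<lambda>x. f (l x)) j k x = fc f (j + k) k (l x)" if x: "x \<in> X" for x
  proof -
    have lx: "l x \<in> X" using bij x by (rule bij_betw_apply)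
    have "fc (\<lambda>x. f (l x)) j k x = (\<Sum>s\<in>{-h..h}. \<Sum>t\<in>{-h..h}. e (j * s + k * t) * f (T s (t - s) (l x)))"
      unfolding fc_def by (simp add: l[OF x])
    also have "\<dots> = (\<Sum>s\<in>{-h..h}. \<Sum>t\<in>{-h..h}. e ((j + k) * s + k * (t + - s)) * f (T s (t + - s) (l x)))"
      by (simp add: algebra_simps)
    also have "\<dots> = (\<Sum>s\<in>{-h..h}. \<Sum>t\<in>{-h..h}. e ((j + k) * s + k * t) * f (T s t (l x)))"
    proof (rule sum.cong[OF refl])
      fix s
      show "(\<Sum>t\<in>{-h..h}. e ((j + k) * s + k * (t + - s)) * f (T s (t + - s) (l x)))
        = (\<Sum>t\<in>{-h..h}. e ((j + k) * s + k * t) * f (T s t (l x)))"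
        by (rule sum_shift_period[OF h_nonneg, where \<phi> = "\<lambda>t. e ((j + k) * s + k * t) * f (T s t (l x))"]) (rule char_T_per2[OF lx])
    qed
    also have "\<dots> = fc f (j + k) k (l x)" unfolding fc_def ..
    finally show ?thesis .
  qed
  then show ?thesis unfolding spec_def
    using sum.reindex_bij_betw[OF bij, where g = "\<lambda>x. (norm (fc f (j + k) k x))\<^sup>2"] by simp
qed

end

text \<open>Add the two bounds: the disjoint images together carry at most
  \<open>sum \<nu> B <= sum \<nu> A + E\<close>, so \<open>2 x <= 3/2 (x + E) + 6 E\<close> for
  \<open>x = sum \<nu> A\<close>, that is \<open>x <= 15 E\<close>.\<close>

lemma ping_pong:
  fixes \<nu> :: "'a \<Rightarrow> real"
  assumes fin: "finite B" and AB: "A \<subseteq> B" and nn: "\<And>z. \<nu> z \<ge> 0"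
    and inj: "inj_on \<alpha> A" "inj_on \<beta> A" and im: "\<alpha> ` A \<subseteq> B" "\<beta> ` A \<subseteq> B" and disj: "\<alpha> ` A \<inter> \<beta> ` A = {}"
    and a: "\<And>z. z \<in> A \<Longrightarrow> \<nu> z \<le> 3/2 * \<nu> (\<alpha> z) + 3 * d1 z" and b: "\<And>z. z \<in> A \<Longrightarrow> \<nu> z \<le> 3/2 * \<nu> (\<beta> z) + 3 * d2 z"
    and d: "sum d1 A \<le> E" "sum d2 A \<le> E" and out: "sum \<nu> (B - A) \<le> E"
  shows "sum \<nu> A \<le> 15 * E"
proof -
  have finA: "finite A" using fin AB by (rule finite_subset[rotated])
  have "sum \<nu> A \<le> (\<Sum>z\<in>A. 3/2 * \<nu> (\<alpha> z) + 3 * d1 z)" by (intro sum_mono a)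
  also have "\<dots> = 3/2 * sum \<nu> (\<alpha> ` A) + 3 * sum d1 A"
    by (simp add: sum.distrib sum_distrib_left sum.reindex[OF inj(1)])
  finally have 1: "sum \<nu> A \<le> 3/2 * sum \<nu> (\<alpha> ` A) + 3 * sum d1 A" .
  have "sum \<nu> A \<le> (\<Sum>z\<in>A. 3/2 * \<nu> (\<beta> z) + 3 * d2 z)" by (intro sum_mono b)
  also have "\<dots> = 3/2 * sum \<nu> (\<beta> ` A) + 3 * sum d2 A"
    by (simp add: sum.distrib sum_distrib_left sum.reindex[OF inj(2)])
  finally have 2: "sum \<nu> A \<le> 3/2 * sum \<nu> (\<beta> ` A) + 3 * sum d2 A" .
  have "sum \<nu> (\<alpha> ` A) + sum \<nu> (\<beta> ` A) = sum \<nu> (\<alpha> ` A \<union> \<beta> ` A)"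
    using finA disj by (simp add: sum.union_disjoint)
  also have "\<dots> \<le> sum \<nu> B" using fin im by (intro sum_mono2) (auto simp: nn)
  also have "\<dots> = sum \<nu> (B - A) + sum \<nu> A" using fin AB by (rule sum.subset_diff[rotated])
  finally show ?thesis using 1 2 d out by linarith
qed

context torus_action
begin

text \<open>The constant is \<open>4 * (15 + 15 + 1)\<close>: ping-pong in each of \<open>Pp\<close>
  and \<open>Pm\<close>, the frequencies outside \<open>Q\<close>, and \<open>|z - 1|^2 <= 4\<close>
  on the unit circle. It depends neither on \<open>h\<close> nor on \<open>a\<close> and
  \<open>b\<close>.\<close>

theorem relative_T:
  assumes bu: "bij_betw u X X" and u: "\<And>s t x. x \<in> X \<Longrightarrow> u (T s t x) = T (s - t) t (u x)"
    and bl: "bij_betw l X X" and l: "\<And>s t x. x \<in> X \<Longrightarrow> l (T s t x) = T s (t - s) (l x)"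
    and D: "nsq (\<lambda>x. f (T 1 0 x) - f x) \<le> D" "nsq (\<lambda>x. f (T 0 1 x) - f x) \<le> D"
      "nsq (\<lambda>x. f (u x) - f x) \<le> D" "nsq (\<lambda>x. f (l x) - f x) \<le> D"
  shows "nsq (\<lambda>x. f (T a b x) - f x) \<le> 124 * D"
proof -
  define m where "m = real_of_int (2 * h + 1) ^ 4"
  have m: "m > 0" using h_nonneg by (simp add: m_def)
  define H where "H = {-h..h} \<times> {-h..h}"
  define Q where "Q = {(j,k). 2 * \<bar>j\<bar> \<le> h \<and> 2 * \<bar>k\<bar> \<le> h}"
  \<comment> \<open>The axes are split so that \<open>Pp\<close> and \<open>Pm\<close> partition the
    nonzero vectors. In \<open>Pp\<close> the entry \<open>j\<close> is nonzero, so the two shears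
    land in \<open>|k| >= |j|\<close> and in \<open>|j| > |k|\<close>; in \<open>Pm\<close> the
    entry \<open>k\<close> is nonzero and does the same for the inverses.\<close>
  define Pp where "Pp = {(j::int,k::int). (j > 0 \<and> k \<ge> 0) \<or> (j < 0 \<and> k \<le> 0)}"
  define Pm where "Pm = {(j::int,k::int). (k > 0 \<and> j \<le> 0) \<or> (k < 0 \<and> j \<ge> 0)}"
  define \<nu> where "\<nu> = (\<lambda>(j,k). spec f j k)"
  define E where "E = m * D"
  have finH: "finite H" by (simp add: H_def)
  have nn: "\<nu> z \<ge> 0" for z by (cases z) (simp add: \<nu>_def spec_nonneg)
  have nsq_minus: "nsq (\<lambda>x. f x - g x) = nsq (\<lambda>x. g x - f x)" for g
    by (simp add: nsq_def norm_minus_commute)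
  have mono: "m * nsq g \<le> E" if "nsq g \<le> D" for g using that m by (simp add: E_def)
  have leD: "(\<Sum>(j,k)\<in>A. spec g j k) \<le> E" if "A \<subseteq> H" "nsq g \<le> D" for A g
    using spec_sum_le[of A g] mono[OF that(2)] that(1) by (simp add: H_def m_def)
  txt \<open>
    Both shears map \<open>Pp\<close> into itself with disjoint images, and their inverses do so for \<open>Pm\<close>. Inside the
    half-size box \<open>Q\<close> no wrap-around mod \<open>2h+1\<close> occurs, and outside of it a translation acts far from trivially.
  \<close>
  have far: "sum \<nu> (H - Q) \<le> E"
  proof -
    define w where "w a b j k = (norm (e (- (j * a + k * b)) - 1))\<^sup>2" for a b j k
    have "\<nu> z \<le> (case z of (j,k) \<Rightarrow> spec (\<lambda>x. f (T 1 0 x) - f x) j k / 2 + spec (\<lambda>x. f (T 0 1 x) - f x) j k / 2)"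
      if z: "z \<in> H - Q" for z
    proof (cases z)
      case (Pair j k)
      have "\<bar>j\<bar> \<le> h" "\<bar>k\<bar> \<le> h" "h < 2 * \<bar>j\<bar> \<or> h < 2 * \<bar>k\<bar>"
        using z by (auto simp: H_def Q_def Pair)
      then have "2 \<le> w 1 0 j k \<or> 2 \<le> w 0 1 j k"
        using root_char_far[OF h_nonneg, of "-j"] root_char_far[OF h_nonneg, of "-k"]
        by (auto simp: w_def)
      moreover have "w 1 0 j k \<ge> 0" "w 0 1 j k \<ge> 0" by (auto simp: w_def)
      ultimately have "2 \<le> w 1 0 j k + w 0 1 j k" by linarith
      then have "2 * spec f j k \<le> (w 1 0 j k + w 0 1 j k) * spec f j k"
        by (intro mult_right_mono spec_nonneg)
      then show ?thesis unfolding Pair spec_T \<nu>_def w_def[symmetric] by (simp add: distrib_right)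
    qed
    then have "sum \<nu> (H - Q) \<le> (\<Sum>z\<in>H-Q. case z of (j,k) \<Rightarrow> spec (\<lambda>x. f (T 1 0 x) - f x) j k / 2 + spec (\<lambda>x. f (T 0 1 x) - f x) j k / 2)"
      by (rule sum_mono)
    also have "\<dots> = (\<Sum>(j,k)\<in>H-Q. spec (\<lambda>x. f (T 1 0 x) - f x) j k) / 2 + (\<Sum>(j,k)\<in>H-Q. spec (\<lambda>x. f (T 0 1 x) - f x) j k) / 2"
      by (simp add: case_prod_beta sum.distrib sum_divide_distrib)
    also have "\<dots> \<le> E / 2 + E / 2" by (intro add_mono divide_right_mono leD D) auto
    finally show ?thesis by simp
  qed
  have su: "spec (\<lambda>x. f (u x)) j k = spec f j (j + k)" for j k by (rule spec_shear1[OF bu u])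
  have sl: "spec (\<lambda>x. f (l x)) j k = spec f (j + k) k" for j k by (rule spec_shear2[OF bl l])
  have up: "\<nu> z \<le> 3/2 * \<nu> ((\<lambda>(j,k). (j, j + k)) z) + 3 * (case z of (j,k) \<Rightarrow> spec (\<lambda>x. f x - f (u x)) j k)" for z
    using spec_triangle[of f "fst z" "snd z" "\<lambda>x. f (u x)"] by (simp add: \<nu>_def su case_prod_beta)
  have lp: "\<nu> z \<le> 3/2 * \<nu> ((\<lambda>(j,k). (j + k, k)) z) + 3 * (case z of (j,k) \<Rightarrow> spec (\<lambda>x. f x - f (l x)) j k)" for z
    using spec_triangle[of f "fst z" "snd z" "\<lambda>x. f (l x)"] by (simp add: \<nu>_def sl case_prod_beta)
  \<comment> \<open>The spectrum of \<open>f o u\<close> at \<open>(j, k - j)\<close> is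
    \<open>\<nu> (j, k)\<close>. The triangle bound at that frequency therefore yields the inverse
    shear from the same hypothesis on \<open>u\<close>.\<close>
  have um: "\<nu> z \<le> 3/2 * \<nu> ((\<lambda>(j,k). (j, k - j)) z) + 3 * (case z of (j,k) \<Rightarrow> spec (\<lambda>x. f (u x) - f x) j (k - j))" for z
    using spec_triangle[of "\<lambda>x. f (u x)" "fst z" "snd z - fst z" f] by (simp add: \<nu>_def su case_prod_beta)
  have lm: "\<nu> z \<le> 3/2 * \<nu> ((\<lambda>(j,k). (j - k, k)) z) + 3 * (case z of (j,k) \<Rightarrow> spec (\<lambda>x. f (l x) - f x) (j - k) k)" for z
    using spec_triangle[of "\<lambda>x. f (l x)" "fst z - snd z" "snd z" f] by (simp add: \<nu>_def sl case_prod_beta)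
  have far_sub: "sum \<nu> (P \<inter> H - P \<inter> H \<inter> Q) \<le> E" for P
  proof -
    have "sum \<nu> (P \<inter> H - P \<inter> H \<inter> Q) \<le> sum \<nu> (H - Q)"
      by (rule sum_mono2) (use finH nn in auto)
    with far show ?thesis by linarith
  qed
  have pp: "sum \<nu> (Pp \<inter> H \<inter> Q) \<le> 15 * E"
  proof (rule ping_pong[where B = "Pp \<inter> H" and \<alpha> = "\<lambda>(j,k). (j, j + k)" and \<beta> = "\<lambda>(j,k). (j + k, k)", OF _ _ nn _ _ _ _ _ up lp _ _ far_sub])
    show "(\<Sum>(j,k)\<in>Pp \<inter> H \<inter> Q. spec (\<lambda>x. f x - f (u x)) j k) \<le> E"
      by (rule leD) (use D nsq_minus in auto)
    show "(\<Sum>(j,k)\<in>Pp \<inter> H \<inter> Q. spec (\<lambda>x. f x - f (l x)) j k) \<le> E"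
      by (rule leD) (use D nsq_minus in auto)
    show "(\<lambda>(j,k). (j, j + k)) ` (Pp \<inter> H \<inter> Q) \<inter> (\<lambda>(j,k). (j + k, k)) ` (Pp \<inter> H \<inter> Q) = {}"
      by (auto simp: Pp_def)
  qed (use finH in \<open>auto simp: inj_on_def Pp_def H_def Q_def\<close>)
  have pm: "sum \<nu> (Pm \<inter> H \<inter> Q) \<le> 15 * E"
  proof (rule ping_pong[where B = "Pm \<inter> H" and \<alpha> = "\<lambda>(j,k). (j, k - j)" and \<beta> = "\<lambda>(j,k). (j - k, k)", OF _ _ nn _ _ _ _ _ um lm _ _ far_sub])
    show "(\<lambda>(j,k). (j, k - j)) ` (Pm \<inter> H \<inter> Q) \<inter> (\<lambda>(j,k). (j - k, k)) ` (Pm \<inter> H \<inter> Q) = {}"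
      by (auto simp: Pm_def)
    have "(\<Sum>(j,k)\<in>Pm \<inter> H \<inter> Q. spec (\<lambda>x. f (u x) - f x) j (k - j))
      = (\<Sum>(j,k)\<in>(\<lambda>(j,k). (j, k - j)) ` (Pm \<inter> H \<inter> Q). spec (\<lambda>x. f (u x) - f x) j k)"
      by (subst sum.reindex) (auto simp: inj_on_def case_prod_beta)
    also have "\<dots> \<le> E" by (rule leD) (auto simp: D H_def Q_def)
    finally show "(\<Sum>(j,k)\<in>Pm \<inter> H \<inter> Q. spec (\<lambda>x. f (u x) - f x) j (k - j)) \<le> E" .
    have "(\<Sum>(j,k)\<in>Pm \<inter> H \<inter> Q. spec (\<lambda>x. f (l x) - f x) (j - k) k)
      = (\<Sum>(j,k)\<in>(\<lambda>(j,k). (j - k, k)) ` (Pm \<inter> H \<inter> Q). spec (\<lambda>x. f (l x) - f x) j k)"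
      by (subst sum.reindex) (auto simp: inj_on_def case_prod_beta)
    also have "\<dots> \<le> E" by (rule leD) (auto simp: D H_def Q_def)
    finally show "(\<Sum>(j,k)\<in>Pm \<inter> H \<inter> Q. spec (\<lambda>x. f (l x) - f x) (j - k) k) \<le> E" .
  qed (use finH in \<open>auto simp: inj_on_def Pm_def H_def Q_def\<close>)
  have tot: "sum \<nu> (H - {(0,0)}) \<le> 31 * E"
  proof -
    have "H - {(0,0)} \<subseteq> (Pp \<inter> H \<inter> Q) \<union> (Pm \<inter> H \<inter> Q) \<union> (H - Q)"
      by (auto simp: Pp_def Pm_def)
    then have "sum \<nu> (H - {(0,0)}) \<le> sum \<nu> ((Pp \<inter> H \<inter> Q) \<union> (Pm \<inter> H \<inter> Q) \<union> (H - Q))"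
      by (intro sum_mono2) (use finH nn in auto)
    also have "\<dots> \<le> sum \<nu> (Pp \<inter> H \<inter> Q) + sum \<nu> (Pm \<inter> H \<inter> Q) + sum \<nu> (H - Q)"
    proof -
      have "sum \<nu> (A \<union> B) \<le> sum \<nu> A + sum \<nu> B" if "finite A" "finite B" for A B
        using sum.union_inter[OF that, of \<nu>] sum_nonneg[of "A \<inter> B" \<nu>] nn by simp
      from this[of "(Pp \<inter> H \<inter> Q) \<union> (Pm \<inter> H \<inter> Q)" "H - Q"] this[of "Pp \<inter> H \<inter> Q" "Pm \<inter> H \<inter> Q"] finH
      show ?thesis by (simp add: finite_subset[of _ H])
    qed
    finally show ?thesis using pp pm far by linarith
  qed
  have "m * nsq (\<lambda>x. f (T a b x) - f x) = (\<Sum>(j,k)\<in>H. (norm (e (- (j * a + k * b)) - 1))\<^sup>2 * spec f j k)"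
    unfolding m_def parseval2[symmetric] H_def spec_T by (rule sum.cartesian_product)
  \<comment> \<open>At the zero frequency the character is 1 and the term vanishes;
    \<open>tot\<close> controls all the others.\<close>
  also have "\<dots> = (\<Sum>(j,k)\<in>H - {(0,0)}. (norm (e (- (j * a + k * b)) - 1))\<^sup>2 * spec f j k)"
    by (rule sum.mono_neutral_right) (use finH in auto)
  also have "\<dots> \<le> (\<Sum>z\<in>H - {(0,0)}. 4 * \<nu> z)"
  proof (rule sum_mono)
    fix z assume "z \<in> H - {(0,0)}"
    have "(norm (e i - 1))\<^sup>2 \<le> 4" for i
    proof -
      have "norm (e i - 1) \<le> 1 + 1" by (rule order_trans[OF norm_triangle_ineq4]) simp
      then have "(norm (e i - 1))\<^sup>2 \<le> 2\<^sup>2" by (intro power_mono) auto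
      then show ?thesis by simp
    qed
    then show "(case z of (j,k) \<Rightarrow> (norm (e (- (j * a + k * b)) - 1))\<^sup>2 * spec f j k) \<le> 4 * \<nu> z"
      by (auto simp: \<nu>_def case_prod_beta intro!: mult_right_mono spec_nonneg)
  qed
  also have "\<dots> \<le> 4 * (31 * E)" using tot by (simp add: sum_distrib_left[symmetric])
  finally have "m * nsq (\<lambda>x. f (T a b x) - f x) \<le> m * (124 * D)" by (simp add: E_def)
  then show ?thesis using m by simp
qed

end

section \<open>Bounded elementary generation modulo a product of two primes\<close>

text \<open>Residue classes are integer matrices with reduced entries rather than elements of a
  quotient type, so the modulus may vary inside a proof.\<close>

definition mmod :: "int \<Rightarrow> int^'n^'n \<Rightarrow> int^'n^'n" where
  "mmod m A = (\<chi> i j. A $ i $ j mod m)"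

lemma mmod_nth [simp]: "mmod m A $ i $ j = A $ i $ j mod m"
  by (simp add: mmod_def)

lemma mmod_mmod [simp]: "mmod m (mmod m A) = mmod m A"
  by (simp add: vec_eq_iff)

lemma mmod_eq_iff: "mmod m A = mmod m B \<longleftrightarrow> (\<forall>i j. [A $ i $ j = B $ i $ j] (mod m))"
  by (auto simp: vec_eq_iff cong_def)

lemma matrix_mult_nth: "(A ** B) $ i $ j = (\<Sum>k\<in>UNIV. A $ i $ k * B $ k $ j)"
  by (simp add: matrix_matrix_mult_def)

lemma mmod_mult_cong: "mmod m A = mmod m A' \<Longrightarrow> mmod m B = mmod m B' \<Longrightarrow> mmod m (A ** B) = mmod m (A' ** B')"
  unfolding mmod_eq_iff matrix_mult_nth by (auto intro!: cong_sum cong_mult)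

lemma mmod_mult_left [simp]: "mmod m (mmod m A ** B) = mmod m (A ** B)"
  by (rule mmod_mult_cong) auto

lemma mmod_mult_right [simp]: "mmod m (A ** mmod m B) = mmod m (A ** B)"
  by (rule mmod_mult_cong) auto

lemma det_cong:
  fixes A B :: "int^'n^'n"
  assumes "\<And>i j. [A $ i $ j = B $ i $ j] (mod m)"
  shows "[det A = det B] (mod m)"
  unfolding det_def using assms by (intro cong_sum cong_mult cong_prod) auto

section \<open>Elementary matrices and elimination modulo one prime at a time\<close>

definition elem :: "'n \<Rightarrow> 'n \<Rightarrow> int \<Rightarrow> int^'n^'n" where
  "elem k l t = (\<chi> i j. (if i = j then 1 else 0) + (if i = k \<and> j = l then t else 0))"

lemma elem_nth: "elem k l t $ i $ j = (if i = j then 1 else 0) + (if i = k \<and> j = l then t else 0)"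
  by (simp add: elem_def)

lemma mult_elem_nth: "(A ** elem k l t) $ i $ j = A $ i $ j + (if j = l then A $ i $ k * t else 0)"
  by (simp add: matrix_mult_nth elem_nth distrib_left sum.distrib if_distrib[where f = "\<lambda>x. _ * x"] cong: if_cong)

lemma elem_mult_nth: "(elem k l t ** A) $ i $ j = A $ i $ j + (if i = k then t * A $ l $ j else 0)"
  by (simp add: matrix_mult_nth elem_nth distrib_right sum.distrib if_distrib[where f = "\<lambda>x. x * _"] cong: if_cong)

lemma elem_zero [simp]: "elem k l 0 = mat 1"
  by (simp add: vec_eq_iff elem_nth mat_def)

lemma det_elem:
  assumes "k \<noteq> l" shows "det (elem k l t :: int^'n^'n) = 1"
proof -
  have "(elem k l t :: int^'n^'n) = (\<chi> i. if i = k then row k (mat 1) + t *s row l (mat 1) else row i (mat 1))"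
    using assms by (auto simp: vec_eq_iff elem_nth row_def mat_def)
  then show ?thesis using det_row_operation[OF assms, of "mat 1" t] by simp
qed

lemma elem_add: "k \<noteq> l \<Longrightarrow> elem k l s ** elem k l t = elem k l (s + t)"
  by (auto simp: vec_eq_iff mult_elem_nth elem_nth)

lemma elem_inverse: "k \<noteq> l \<Longrightarrow> elem k l t ** elem k l (- t) = mat 1" "k \<noteq> l \<Longrightarrow> elem k l (- t) ** elem k l t = mat 1"
  by (simp_all add: elem_add)

lemma elem_cong: "[s = t] (mod m) \<Longrightarrow> mmod m (elem k l s) = mmod m (elem k l t)"
  by (auto simp: mmod_eq_iff elem_nth intro: cong_add)

lemma elem_in_SL: "k \<noteq> l \<Longrightarrow> elem k l t \<in> SL_int"
  by (simp add: SL_int_def det_elem)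

lemma transpose_elem: "transpose (elem k l t) = elem l k t"
  by (auto simp: vec_eq_iff transpose_def elem_nth)

text \<open>
  \<open>reach q c A B\<close>: at most \<open>c\<close> row or column operations with multipliers divisible by \<open>q\<close> lead from \<open>A\<close> to \<open>B\<close>.
  They do not change the matrix mod \<open>q\<close>, so \<open>A\<close> can be reduced mod \<open>p\<close> and then mod \<open>q\<close>.
\<close>
inductive reach :: "int \<Rightarrow> nat \<Rightarrow> int^'n^'n \<Rightarrow> int^'n^'n \<Rightarrow> bool" for q where
  stay: "reach q c A A"
| row_op: "reach q c A B \<Longrightarrow> k \<noteq> l \<Longrightarrow> q dvd t \<Longrightarrow> reach q (Suc c) A (elem k l t ** B)"
| col_op: "reach q c A B \<Longrightarrow> k \<noteq> l \<Longrightarrow> q dvd t \<Longrightarrow> reach q (Suc c) A (B ** elem k l t)"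

lemma reach_trans: "reach q d B C \<Longrightarrow> reach q c A B \<Longrightarrow> reach q (c + d) A C"
proof (induction rule: reach.induct)
  case (stay d B)
  from stay show ?case
  proof (induction rule: reach.induct)
    case (row_op c A B k l t)
    then show ?case using reach.row_op by fastforce
  next
    case (col_op c A B k l t)
    then show ?case using reach.col_op by fastforce
  qed (rule reach.stay)
qed (auto intro: reach.row_op reach.col_op)

lemma reach_mono: "reach q c A B \<Longrightarrow> c \<le> d \<Longrightarrow> reach q d A B"
  using reach_trans[OF reach.stay[of q "d - c" B]] by fastforce

lemma reach_dvd: "reach q c A B \<Longrightarrow> r dvd q \<Longrightarrow> reach r c A B"
  by (induction rule: reach.induct) (auto intro: reach.intros dvd_trans)

lemma reach_det: "reach q c A B \<Longrightarrow> det B = det A"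
  by (induction rule: reach.induct) (simp_all add: det_mul det_elem)

lemma reach_mmod: "reach q c A B \<Longrightarrow> mmod q B = mmod q A"
proof (induction rule: reach.induct)
  case (row_op c A B k l t)
  have "mmod q (elem k l t) = mmod q (elem k l 0)"
    using row_op by (intro elem_cong) (simp add: cong_0_iff)
  then have "mmod q (elem k l t ** B) = mmod q (mat 1 ** B)" by (intro mmod_mult_cong) auto
  with row_op show ?case by simp
next
  case (col_op c A B k l t)
  have "mmod q (elem k l t) = mmod q (elem k l 0)"
    using col_op by (intro elem_cong) (simp add: cong_0_iff)
  then have "mmod q (B ** elem k l t) = mmod q (B ** mat 1)" by (intro mmod_mult_cong) auto
  with col_op show ?case by simp
qed simp

lemma reach_transpose: "reach q c A B \<Longrightarrow> reach q c (transpose A) (transpose B)"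
  by (induction rule: reach.induct) (auto simp: matrix_transpose_mul transpose_elem intro: reach.intros)

definition reduced :: "int \<Rightarrow> 'n set \<Rightarrow> int^'n^'n \<Rightarrow> bool" where
  "reduced p Z A \<longleftrightarrow> (\<forall>k\<in>Z. \<forall>l. [A $ k $ l = (if k = l then 1 else 0)] (mod p) \<and> [A $ l $ k = (if k = l then 1 else 0)] (mod p))"

lemma reducedD:
  assumes "reduced p Z A" "k \<in> Z"
  shows "[A $ k $ l = (if k = l then 1 else 0)] (mod p)" "[A $ l $ k = (if k = l then 1 else 0)] (mod p)"
  using assms unfolding reduced_def by blast+

lemma reducedD_ne:
  assumes "reduced p Z A" "k \<in> Z" "k \<noteq> l"
  shows "[A $ k $ l = 0] (mod p)" "[A $ l $ k = 0] (mod p)"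
  using reducedD[OF assms(1,2), of l] assms(3) by auto

lemma reduced_transpose: "reduced p Z (transpose A) \<longleftrightarrow> reduced p Z A"
  by (auto simp: reduced_def transpose_def)

lemma reduced_row:
  assumes "reduced p Z A" "k \<notin> Z" "l \<notin> Z"
  shows "reduced p Z (elem k l t ** A)"
  unfolding reduced_def
proof (intro ballI allI conjI)
  fix z i assume z: "z \<in> Z"
  show "[(elem k l t ** A) $ z $ i = (if z = i then 1 else 0)] (mod p)"
    using reducedD(1)[OF assms(1) z, of i] assms(2) z by (auto simp: elem_mult_nth)
  have "[A $ i $ z = (if z = i then 1 else 0)] (mod p)" "[A $ l $ z = 0] (mod p)"
    using reducedD(2)[OF assms(1) z, of i] reducedD_ne(2)[OF assms(1) z, of l] assms(3) z by auto
  then have "[A $ i $ z + (if i = k then t * A $ l $ z else 0) = (if z = i then 1 else 0) + 0] (mod p)"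
    by (intro cong_add) (auto simp: cong_0_iff)
  then show "[(elem k l t ** A) $ i $ z = (if z = i then 1 else 0)] (mod p)"
    by (simp add: elem_mult_nth)
qed

text \<open>Only rows in \<open>R\<close> change, each once, by a multiple of the pivot row
  \<open>k\<close>. That row \<open>k\<close> survives verbatim is recorded for the second pass on
  the transpose, which must not spoil the column already cleared.\<close>

lemma clear_column:
  fixes A :: "int^'n^'n"
  assumes cop: "coprime q p" and "finite R"
  shows "k \<notin> Z \<Longrightarrow> R \<inter> insert k Z = {} \<Longrightarrow> reduced p Z A \<Longrightarrow> [A $ k $ k = 1] (mod p) \<Longrightarrow>
    \<exists>B. reach q (card R) A B \<and> reduced p Z B \<and> (\<forall>j. B $ k $ j = A $ k $ j) \<and> (\<forall>r\<in>R. [B $ r $ k = 0] (mod p))"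
  using \<open>finite R\<close>
proof (induction R rule: finite_induct)
  case empty
  then show ?case by (auto intro: reach.stay)
next
  case (insert r R)
  then obtain B where B: "reach q (card R) A B" "reduced p Z B" "\<forall>j. B $ k $ j = A $ k $ j" "\<forall>r\<in>R. [B $ r $ k = 0] (mod p)"
    by auto
  obtain q' where q': "[q * q' = 1] (mod p)" using cop cong_solve_coprime_int by blast
  have rk: "r \<noteq> k" "r \<notin> Z" using insert by auto
  \<comment> \<open>\<open>q * q'\<close> is divisible by \<open>q\<close> and is 1 mod
    \<open>p\<close>: the multiplier is admissible, yet acts mod \<open>p\<close> as
    \<open>- B $ r $ k\<close>.\<close>
  define t where "t = - B $ r $ k * (q * q')"
  define C where "C = elem r k t ** B"
  have "[B $ r $ k + t * B $ k $ k = B $ r $ k + (- B $ r $ k * 1) * 1] (mod p)"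
    unfolding t_def using q' insert.prems(4) B(3) by (intro cong_add cong_mult cong_refl) auto
  then have "[C $ r $ k = 0] (mod p)" by (simp add: C_def elem_mult_nth)
  moreover have "[C $ s $ k = 0] (mod p)" if "s \<in> R" for s
    using B(4) that insert.hyps by (auto simp: C_def elem_mult_nth)
  moreover have "C $ k $ j = A $ k $ j" for j using B(3) rk by (simp add: C_def elem_mult_nth)
  moreover have "reduced p Z C" unfolding C_def using B(2) rk(2) insert.prems(1) by (rule reduced_row)
  moreover have "reach q (Suc (card R)) A C"
    unfolding C_def by (rule reach.row_op[OF B(1) rk(1)]) (simp add: t_def)
  ultimately show ?case using insert.hyps by auto
qed

text \<open>Replacing a column that vanishes mod \<open>p\<close> by 0 keeps the determinant mod
  \<open>p\<close> and makes it 0.\<close>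

lemma column_not_zero_mod:
  fixes A :: "int^'n^'n"
  assumes p: "prime p" and det: "[det A = 1] (mod p)"
  shows "\<exists>r. \<not> p dvd A $ r $ k"
proof (rule ccontr)
  assume "\<not> ?thesis"
  then have z: "p dvd A $ r $ k" for r by blast
  have "[det A = det (\<chi> i j. if j = k then 0 else A $ i $ j)] (mod p)"
    by (rule det_cong) (auto simp: z cong_0_iff)
  also have "det (\<chi> i j. if j = k then 0 else A $ i $ j) = det (transpose (\<chi> i j. if j = k then 0 else A $ i $ j))"
    by (rule det_transpose[symmetric])
  also have "\<dots> = 0"
    by (rule det_zero_row(1)[of k]) (simp add: vec_eq_iff transpose_def row_def)
  finally have "[1 = 0] (mod p)" using det cong_sym cong_trans by blast
  then show False using p by (metis cong_0_iff not_prime_unit)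
qed

text \<open>At most one operation produces a unit of column \<open>k\<close> outside
  \<open>insert k Z\<close>, one turns the pivot into 1, and each of the two sweeps takes at most
  \<open>CARD('n)\<close>; hence \<open>2 + 2 * CARD('n)\<close>. The spare index \<open>k2\<close>
  serves when the only unit found is the pivot itself, since an operation needs two different
  rows.\<close>

lemma reduce_step:
  fixes A :: "int^'n^'n"
  assumes p: "prime p" and cop: "coprime q p" and det: "[det A = 1] (mod p)"
    and Z: "reduced p Z A" and k: "k \<notin> Z" and k2: "k2 \<notin> insert k Z"
  shows "\<exists>B. reach q (2 + 2 * CARD('n)) A B \<and> reduced p (insert k Z) B"
proof -
  obtain q' where q': "[q * q' = 1] (mod p)" using cop cong_solve_coprime_int by blast
  have pq: "\<not> p dvd q" using cop p by (metis coprime_absorb_right not_prime_unit)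
  obtain r where r: "\<not> p dvd A $ r $ k" using column_not_zero_mod[OF p det] by blast
  have rZ: "r \<notin> Z"
  proof
    assume "r \<in> Z"
    then have "[A $ r $ k = 0] (mod p)" using reducedD_ne(1)[OF Z, of r k] k by auto
    with r show False by (simp add: cong_0_iff)
  qed
  obtain A1 r1 where A1: "reach q 1 A A1" "reduced p Z A1" "r1 \<notin> insert k Z" "\<not> p dvd A1 $ r1 $ k"
  proof (cases "p dvd A $ k2 $ k \<and> r = k")
    case True
    have "\<not> p dvd A $ k2 $ k + q * A $ k $ k"
      using True r pq p by (auto simp: dvd_add_right_iff prime_dvd_mult_iff)
    then have "\<not> p dvd (elem k2 k q ** A) $ k2 $ k" by (simp add: elem_mult_nth)
    moreover have "reach q (Suc 0) A (elem k2 k q ** A)" using k2 by (intro reach.row_op reach.stay) auto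
    moreover have "reduced p Z (elem k2 k q ** A)" using Z k k2 by (intro reduced_row) auto
    ultimately show ?thesis using that[of "elem k2 k q ** A" k2] k2 by auto
  next
    case False
    then show ?thesis using that[of A r] that[of A k2] r rZ k2 Z reach.stay[of q 1 A] by auto
  qed
  obtain x where x: "[A1 $ r1 $ k * x = 1] (mod p)"
    using A1(4) p cong_solve_coprime_int by (metis coprime_commute prime_imp_coprime)
  \<comment> \<open>As \<open>x\<close> inverts the entry in row \<open>r1\<close> mod
    \<open>p\<close>, adding \<open>t\<close> times that row moves the pivot to 1, with
    \<open>t\<close> still divisible by \<open>q\<close>.\<close>
  define t where "t = q * q' * x * (1 - A1 $ k $ k)"
  define A2 where "A2 = elem k r1 t ** A1"
  have "[A1 $ k $ k + (q * q') * (A1 $ r1 $ k * x) * (1 - A1 $ k $ k) = A1 $ k $ k + 1 * 1 * (1 - A1 $ k $ k)] (mod p)"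
    using q' x by (intro cong_add cong_mult cong_refl)
  then have A2k: "[A2 $ k $ k = 1] (mod p)" by (simp add: A2_def elem_mult_nth t_def algebra_simps)
  have A2: "reach q 2 A A2" "reduced p Z A2"
    using reach.row_op[OF A1(1), of k r1 t] A1 k by (auto simp: A2_def t_def numeral_2_eq_2 intro: reduced_row)
  define R where "R = UNIV - insert k Z"
  have R: "finite R" "R \<inter> insert k Z = {}" "card R \<le> CARD('n)" by (auto simp: R_def intro: card_mono)
  obtain B where B: "reach q (card R) A2 B" "reduced p Z B" "\<And>j. B $ k $ j = A2 $ k $ j" "\<And>r. r \<in> R \<Longrightarrow> [B $ r $ k = 0] (mod p)"
    using clear_column[OF cop R(1) k R(2) A2(2) A2k] by blast
  have Bk: "[transpose B $ k $ k = 1] (mod p)" using A2k B(3) by (simp add: transpose_def)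
  obtain C where C: "reach q (card R) (transpose B) C" "reduced p Z C" "\<And>j. C $ k $ j = transpose B $ k $ j" "\<And>r. r \<in> R \<Longrightarrow> [C $ r $ k = 0] (mod p)"
    using clear_column[OF cop R(1) k R(2) _ Bk] B(2) by (auto simp: reduced_transpose)
  have D: "reach q (card R) B (transpose C)" using reach_transpose[OF C(1)] by simp
  have "reach q (2 + card R + card R) A (transpose C)"
    using reach_trans[OF D reach_trans[OF B(1) A2(1)]] by simp
  then have "reach q (2 + 2 * CARD('n)) A (transpose C)"
    by (rule reach_mono) (use R(3) in auto)
  moreover have "reduced p (insert k Z) (transpose C)"
    unfolding reduced_transpose
  proof (subst reduced_def, intro ballI allI)
    fix i j assume i: "i \<in> insert k Z"
    show "[C $ i $ j = (if i = j then 1 else 0)] (mod p) \<and> [C $ j $ i = (if i = j then 1 else 0)] (mod p)"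
    proof (cases "i \<in> Z \<or> j \<in> Z")
      case True
      then show ?thesis
        using reducedD[OF C(2), of i j] reducedD[OF C(2), of j i] by (auto simp: eq_commute[of j i])
    next
      case False
      then have ik: "i = k" using i by auto
      show ?thesis
      proof (cases "j = k")
        case True
        then show ?thesis using ik Bk C(3)[of k] by simp
      next
        case False
        then have "j \<in> R" using \<open>\<not> (i \<in> Z \<or> j \<in> Z)\<close> by (simp add: R_def)
        then show ?thesis using ik C(3)[of j] C(4)[of j] B(4)[of j] False by (auto simp: transpose_def)
      qed
    qed
  qed
  ultimately show ?thesis by blast
qed

lemma reach_reduced:
  fixes A :: "int^'n^'n"
  assumes p: "prime p" and cop: "coprime q p" and det: "[det A = 1] (mod p)"
  shows "Z \<noteq> UNIV \<Longrightarrow> \<exists>B. reach q (card Z * (2 + 2 * CARD('n))) A B \<and> reduced p Z B"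
  using finite[of Z]
proof (induction Z rule: finite_induct)
  case empty
  have "reduced p {} A" by (simp add: reduced_def)
  then show ?case using reach.stay by blast
next
  case (insert k Z)
  then obtain k2 where k2: "k2 \<notin> insert k Z" by auto
  from insert obtain B where B: "reach q (card Z * (2 + 2 * CARD('n))) A B" "reduced p Z B" by auto
  have "[det B = 1] (mod p)" using det reach_det[OF B(1)] by simp
  from reduce_step[OF p cop this B(2) insert.hyps(2) k2]
  obtain C where C: "reach q (2 + 2 * CARD('n)) B C" "reduced p (insert k Z) C" by blast
  have "reach q (card (insert k Z) * (2 + 2 * CARD('n))) A C"
    by (rule reach_mono[OF reach_trans[OF C(1) B(1)]]) (simp add: insert.hyps)
  with C(2) show ?case by blast
qed

text \<open>Elimination needs a spare index and so stops one short. The matrix is then diagonal mod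
  \<open>p\<close> with one unknown diagonal entry, and that entry is the determinant.\<close>

lemma reach_identity:
  fixes A :: "int^'n^'n"
  assumes p: "prime p" and cop: "coprime q p" and det: "[det A = 1] (mod p)"
  shows "\<exists>B. reach q (CARD('n) * (2 + 2 * CARD('n))) A B \<and> mmod p B = mmod p (mat 1)"
proof -
  obtain k :: 'n where True by blast
  obtain B where B: "reach q (card (UNIV - {k}) * (2 + 2 * CARD('n))) A B" "reduced p (UNIV - {k}) B"
    using reach_reduced[OF assms, of "UNIV - {k}"] by auto
  have off: "[B $ i $ j = (if i = j then 1 else 0)] (mod p)" if "i \<noteq> k \<or> j \<noteq> k" for i j
    using reducedD(1)[OF B(2), of i j] reducedD(2)[OF B(2), of j i] that by (auto simp: eq_commute[of j i])
  define D :: "int^'n^'n" where "D = (\<chi> i j. if i = j then (if i = k then B $ k $ k else 1) else 0)"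
  have "[det B = det D] (mod p)"
  proof (rule det_cong)
    fix i j show "[B $ i $ j = D $ i $ j] (mod p)"
      using off[of i j] by (cases "i = k \<and> j = k") (auto simp: D_def split: if_splits)
  qed
  also have "det D = (\<Prod>i\<in>UNIV. D $ i $ i)" by (rule det_diagonal) (simp add: D_def)
  also have "\<dots> = B $ k $ k" by (simp add: D_def)
  finally have "[B $ k $ k = 1] (mod p)"
    using det reach_det[OF B(1)] cong_sym cong_trans by metis
  then have "[B $ i $ j = mat 1 $ i $ j] (mod p)" for i j
    using off[of i j] by (cases "i = k \<and> j = k") (auto simp: mat_def split: if_splits)
  then have "mmod p B = mmod p (mat 1)" by (simp add: mmod_eq_iff)
  moreover have "reach q (CARD('n) * (2 + 2 * CARD('n))) A B"
    by (rule reach_mono[OF B(1)], intro mult_le_mono1 card_mono) auto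
  ultimately show ?thesis by blast
qed

lemma bounded_elementary_generation:
  fixes A :: "int^'n^'n"
  assumes p: "prime p" and q: "prime q" and ne: "p \<noteq> q" and A: "A \<in> SL_int"
  shows "\<exists>B. reach 1 (2 * (CARD('n) * (2 + 2 * CARD('n)))) A B \<and> mmod (p * q) B = mmod (p * q) (mat 1)"
proof -
  have cop: "coprime q p" "coprime p q" using p q ne by (auto intro: primes_coprime)
  obtain B where B: "reach q (CARD('n) * (2 + 2 * CARD('n))) A B" "mmod p B = mmod p (mat 1)"
    using reach_identity[OF p cop(1), of A] A by (auto simp: SL_int_def)
  have "det B = 1" using reach_det[OF B(1)] A by (simp add: SL_int_def)
  then obtain C where C: "reach p (CARD('n) * (2 + 2 * CARD('n))) B C" "mmod q C = mmod q (mat 1)"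
    using reach_identity[OF q cop(2), of B] by auto
  have "mmod p C = mmod p (mat 1)" using reach_mmod[OF C(1)] B(2) by simp
  then have "mmod (p * q) C = mmod (p * q) (mat 1)"
    using C(2) cop(2) by (auto simp: mmod_eq_iff intro: coprime_cong_mult)
  moreover have "reach 1 (2 * (CARD('n) * (2 + 2 * CARD('n)))) A C"
    using reach_trans[OF reach_dvd[OF C(1)] reach_dvd[OF B(1)], of 1]
    by (simp only: mult_2 one_dvd)
  ultimately show ?thesis by blast
qed

section \<open>A spectral gap for congruence quotients\<close>

text \<open>Defined as an image, so that each element comes with a lift to an integral matrix of
  determinant 1.\<close>

definition SL_mod :: "int \<Rightarrow> (int^'n^'n) set" where
  "SL_mod m = mmod m ` SL_int"

text \<open>Functions on the quotient are kept as functions of integer matrices, so a translate such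
  as \<open>F (A ** g)\<close> needs no reduction of its argument.\<close>

definition mod_periodic :: "int \<Rightarrow> (int^'n^'n \<Rightarrow> 'a) \<Rightarrow> bool" where
  "mod_periodic m F \<longleftrightarrow> (\<forall>A. F (mmod m A) = F A)"

lemma mod_periodicD: "mod_periodic m F \<Longrightarrow> F (mmod m A) = F A"
  by (simp add: mod_periodic_def)

lemma mod_periodic_eq: "mod_periodic m F \<Longrightarrow> mmod m A = mmod m B \<Longrightarrow> F A = F B"
  by (metis mod_periodic_def)

lemma mod_periodic_right: "mod_periodic m F \<Longrightarrow> mod_periodic m (\<lambda>A. F (A ** g))"
  unfolding mod_periodic_def by (metis mmod_mult_left)

lemma finite_SL_mod: "finite (SL_mod m :: (int^'n^'n) set)"
  and card_SL_mod_le: "card (SL_mod m :: (int^'n^'n) set) \<le> nat m ^ (CARD('n) * CARD('n))" if "m > 0"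
proof -
  let ?f = "\<lambda>A :: int^'n^'n. \<lambda>p. A $ fst p $ snd p"
  have inj: "inj_on ?f (SL_mod m)"
    by (rule inj_onI) (simp add: vec_eq_iff fun_eq_iff)
  have im: "?f ` SL_mod m \<subseteq> UNIV \<rightarrow>\<^sub>E {0..<m}"
    using that by (auto simp: SL_mod_def)
  have fin: "finite (UNIV \<rightarrow>\<^sub>E {0..<m} :: ('n \<times> 'n \<Rightarrow> int) set)" by (intro finite_PiE) auto
  show "finite (SL_mod m :: (int^'n^'n) set)"
    using finite_subset[OF im fin] inj by (rule finite_imageD)
  have "card (SL_mod m :: (int^'n^'n) set) \<le> card (UNIV \<rightarrow>\<^sub>E {0..<m} :: ('n \<times> 'n \<Rightarrow> int) set)"
    by (rule card_inj_on_le[OF inj im fin])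
  also have "\<dots> = nat m ^ (CARD('n) * CARD('n))" by (simp add: card_PiE)
  finally show "card (SL_mod m :: (int^'n^'n) set) \<le> nat m ^ (CARD('n) * CARD('n))" .
qed

lemma SL_int_mult: "A \<in> SL_int \<Longrightarrow> B \<in> SL_int \<Longrightarrow> A ** B \<in> SL_int"
  by (simp add: SL_int_def det_mul)

lemma SL_int_one: "mat 1 \<in> SL_int"
  by (simp add: SL_int_def)

lemma SL_mod_mult_right: "A \<in> SL_mod m \<Longrightarrow> g \<in> SL_int \<Longrightarrow> mmod m (A ** g) \<in> SL_mod m"
  by (auto simp: SL_mod_def intro: SL_int_mult)

lemma SL_mod_mult_left: "A \<in> SL_mod m \<Longrightarrow> g \<in> SL_int \<Longrightarrow> mmod m (g ** A) \<in> SL_mod m"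
  by (auto simp: SL_mod_def intro: SL_int_mult)

lemma mmod_SL_mod: "A \<in> SL_mod m \<Longrightarrow> mmod m A = A"
  by (auto simp: SL_mod_def)

lemma SL_mod_one: "mmod m (mat 1) \<in> SL_mod m"
  by (simp add: SL_mod_def SL_int_one)

lemma three_indices:
  assumes "CARD('n) \<ge> 3"
  obtains b :: "'n::finite" where "b \<noteq> x" "b \<noteq> y"
proof -
  have "card {x, y} < CARD('n)" using assms card_insert_le_m1[of 2 "{y}" x] by simp
  then have "{x, y} \<noteq> UNIV" by auto
  then show thesis using that by auto
qed

section \<open>Displacement of a function under right translation, from generators to elementary
  matrices\<close>

definition dis :: "int \<Rightarrow> (int^'n^'n \<Rightarrow> real) \<Rightarrow> int^'n^'n \<Rightarrow> real" where
  "dis m F g = L2_set (\<lambda>A. F (A ** g) - F A) (SL_mod m)"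

lemma dis_nonneg: "dis m F g \<ge> 0"
  by (simp add: dis_def)

lemma dis_power2: "(dis m F g)\<^sup>2 = (\<Sum>A\<in>SL_mod m. (F (A ** g) - F A)\<^sup>2)"
  by (simp add: dis_def L2_set_def sum_nonneg)

lemma dis_one [simp]: "dis m F (mat 1) = 0"
  by (simp add: dis_def L2_set_0')

lemma dis_cong: "mod_periodic m F \<Longrightarrow> mmod m g = mmod m h \<Longrightarrow> dis m F g = dis m F h"
  unfolding dis_def by (subst mod_periodic_eq[OF _ mmod_mult_cong[OF refl]]) auto

lemma word_prod_append: "word_prod (u @ v) = word_prod u ** word_prod v"
  by (induction u) (simp_all add: word_prod_def matrix_mul_assoc)

lemma word_prod_Nil [simp]: "word_prod [] = mat 1"
  by (simp add: word_prod_def)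

lemma word_prod_Cons [simp]: "word_prod (s # w) = s ** word_prod w"
  by (simp add: word_prod_def)

locale sl_generators =
  fixes S :: "(int^'n^'n) set"
  assumes dim3: "CARD('n) \<ge> 3" and finite_S: "finite S" and S_SL: "S \<subseteq> SL_int"
    and symm: "symmetric_set S" and gens: "gen_subgroup S = SL_int"
begin

lemma S_inverse:
  assumes "s \<in> S" shows "\<exists>t\<in>S. s ** t = mat 1 \<and> t ** s = mat 1"
proof -
  obtain t where t: "t \<in> S" "s ** t = mat 1" using symm assms by (auto simp: symmetric_set_def)
  obtain r where r: "r \<in> S" "t ** r = mat 1" using symm t by (auto simp: symmetric_set_def)
  have "s = s ** (t ** r)" by (simp add: r)
  also have "\<dots> = r" by (simp add: matrix_mul_assoc t)
  finally show ?thesis using t r by auto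
qed

text \<open>The inverse word is carried along with equal length so that a commutator of two words
  has even length; taking inverses merely swaps the two words.\<close>

lemma SL_int_word:
  assumes "g \<in> SL_int"
  shows "\<exists>w w'. set w \<subseteq> S \<and> set w' \<subseteq> S \<and> length w' = length w \<and> word_prod w = g \<and>
    g ** word_prod w' = mat 1 \<and> word_prod w' ** g = mat 1"
  using assms unfolding gens[symmetric]
proof (induction rule: gen_subgroup.induct)
  case gen_one
  show ?case by (rule exI[of _ "[]"], rule exI[of _ "[]"]) simp
next
  case (gen_base s)
  then obtain t where "t \<in> S" "s ** t = mat 1" "t ** s = mat 1" using S_inverse by blast
  with gen_base show ?case by (intro exI[of _ "[s]"] exI[of _ "[t]"]) simp
next
  case (gen_mult a b)
  then obtain w w' v v' where *: "set w \<subseteq> S" "set w' \<subseteq> S" "length w' = length w" "word_prod w = a"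
      "a ** word_prod w' = mat 1" "word_prod w' ** a = mat 1"
      "set v \<subseteq> S" "set v' \<subseteq> S" "length v' = length v" "word_prod v = b"
      "b ** word_prod v' = mat 1" "word_prod v' ** b = mat 1"
    by blast
  have "(a ** b) ** (word_prod v' ** word_prod w') = a ** (b ** word_prod v') ** word_prod w'"
    by (simp only: matrix_mul_assoc)
  then have 1: "(a ** b) ** word_prod (v' @ w') = mat 1" by (simp add: * word_prod_append)
  have "(word_prod v' ** word_prod w') ** (a ** b) = word_prod v' ** (word_prod w' ** a) ** b"
    by (simp only: matrix_mul_assoc)
  then have 2: "word_prod (v' @ w') ** (a ** b) = mat 1" by (simp add: * word_prod_append)
  show ?case
    by (rule exI[of _ "w @ v"], rule exI[of _ "v' @ w'"]) (use * 1 2 in \<open>simp add: word_prod_append\<close>)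
next
  case (gen_inv a b)
  then obtain w w' where *: "set w \<subseteq> S" "set w' \<subseteq> S" "length w' = length w" "word_prod w = a"
      "a ** word_prod w' = mat 1" "word_prod w' ** a = mat 1"
    by blast
  have "b = (word_prod w' ** a) ** b" by (simp add: *)
  also have "\<dots> = word_prod w'" using gen_inv by (simp add: matrix_mul_assoc[symmetric])
  finally show ?case using * by (intro exI[of _ w'] exI[of _ w]) simp
qed

lemma SL_int_inverse:
  fixes g :: "int^'n^'n"
  assumes "g \<in> SL_int" obtains g' where "g' \<in> SL_int" "g ** g' = mat 1" "g' ** g = mat 1"
proof -
  obtain g' where g': "g ** g' = mat 1" "g' ** g = mat 1" using SL_int_word[OF assms] by blast
  have "det (g ** g') = 1" by (simp add: g')
  then have "g' \<in> SL_int" using assms by (simp add: SL_int_def det_mul)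
  with that g' show thesis by blast
qed

lemma bij_SL_mod_right:
  fixes g :: "int^'n^'n"
  assumes "g \<in> SL_int" shows "bij_betw (\<lambda>A. mmod m (A ** g)) (SL_mod m) (SL_mod m)"
proof -
  obtain g' where g': "g' \<in> SL_int" "g ** g' = mat 1" "g' ** g = mat 1" using SL_int_inverse[OF assms] .
  show ?thesis
    by (rule bij_betw_byWitness[where f' = "\<lambda>A. mmod m (A ** g')"])
      (auto simp: matrix_mul_assoc[symmetric] g' mmod_SL_mod intro: SL_mod_mult_right assms)
qed

lemma bij_SL_mod_left:
  fixes g :: "int^'n^'n"
  assumes "g \<in> SL_int" shows "bij_betw (\<lambda>A. mmod m (g ** A)) (SL_mod m) (SL_mod m)"
proof -
  obtain g' where g': "g' \<in> SL_int" "g ** g' = mat 1" "g' ** g = mat 1" using SL_int_inverse[OF assms] .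
  show ?thesis
    by (rule bij_betw_byWitness[where f' = "\<lambda>A. mmod m (g' ** A)"])
      (auto simp: matrix_mul_assoc g' mmod_SL_mod intro: SL_mod_mult_left assms)
qed

lemma sum_mult_right:
  fixes g :: "int^'n^'n"
  assumes "mod_periodic m F" "g \<in> SL_int"
  shows "(\<Sum>A\<in>SL_mod m. F (A ** g)) = (\<Sum>A\<in>SL_mod m. F A)"
  using sum.reindex_bij_betw[OF bij_SL_mod_right[OF assms(2), of m], of F] by (simp add: mod_periodicD[OF assms(1)])

lemma sum_mult_left:
  fixes g :: "int^'n^'n"
  assumes "mod_periodic m F" "g \<in> SL_int"
  shows "(\<Sum>A\<in>SL_mod m. F (g ** A)) = (\<Sum>A\<in>SL_mod m. F A)"
  using sum.reindex_bij_betw[OF bij_SL_mod_left[OF assms(2), of m], of F] by (simp add: mod_periodicD[OF assms(1)])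

text \<open>Right translation by \<open>g\<close> permutes \<open>SL_mod m\<close>, so the
  displacement by \<open>h\<close> measured at \<open>A ** g\<close> has the same norm; the rest is
  the triangle inequality.\<close>

lemma dis_mult:
  fixes g :: "int^'n^'n"
  assumes F: "mod_periodic m F" and g: "g \<in> SL_int"
  shows "dis m F (g ** h) \<le> dis m F g + dis m F h"
proof -
  let ?G = "\<lambda>A. (F (A ** h) - F A)\<^sup>2"
  have G: "mod_periodic m ?G"
    using F mod_periodic_right[OF F, of h] by (simp add: mod_periodic_def)
  have "L2_set (\<lambda>A. F (A ** g ** h) - F (A ** g)) (SL_mod m) = dis m F h"
    using sum_mult_right[OF G g] by (simp add: dis_def L2_set_def)
  moreover have "dis m F (g ** h) = L2_set (\<lambda>A. (F (A ** g) - F A) + (F (A ** g ** h) - F (A ** g))) (SL_mod m)"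
    by (simp add: dis_def matrix_mul_assoc)
  moreover have "\<dots> \<le> dis m F g + L2_set (\<lambda>A. F (A ** g ** h) - F (A ** g)) (SL_mod m)"
    unfolding dis_def by (rule L2_set_triangle_ineq)
  ultimately show ?thesis by simp
qed

lemma dis_reach:
  fixes A :: "int^'n^'n"
  assumes F: "mod_periodic m F" and d: "\<And>k l t. k \<noteq> l \<Longrightarrow> dis m F (elem k l t) \<le> d"
    and A: "A \<in> SL_int" and "reach 1 c A B"
  shows "dis m F A \<le> real c * d + dis m F B"
  using assms(4,3)
proof (induction rule: reach.induct)
  case (stay c A)
  \<comment> \<open>\<open>stay\<close> permits a count above 0, so \<open>d >= 0\<close> is
    required; any pair of distinct indices gives it.\<close>
  obtain k :: 'n where "k \<noteq> undefined" using three_indices[OF dim3] .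
  from d[OF this] have "d \<ge> 0" using dis_nonneg order_trans by blast
  then show ?case by simp
next
  case (row_op c A B k l t)
  let ?e = "elem k l"
  have "dis m F B = dis m F (?e (- t) ** (?e t ** B))"
    using row_op.hyps(2) by (simp add: matrix_mul_assoc elem_inverse)
  also have "\<dots> \<le> dis m F (?e (- t)) + dis m F (?e t ** B)"
    by (rule dis_mult[OF F]) (use row_op.hyps in \<open>simp add: elem_in_SL\<close>)
  finally show ?case using row_op.IH[OF row_op.prems] d[OF row_op.hyps(2), of "- t"] unfolding of_nat_Suc distrib_right by linarith
next
  case (col_op c A B k l t)
  let ?e = "elem k l"
  have B: "B ** ?e t \<in> SL_int"
    using col_op.prems reach_det[OF col_op.hyps(1)] by (simp add: SL_int_def det_mul det_elem[OF col_op.hyps(2)])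
  have "dis m F B = dis m F ((B ** ?e t) ** ?e (- t))"
    using col_op.hyps(2) by (simp add: matrix_mul_assoc[symmetric] elem_inverse(1))
  also have "\<dots> \<le> dis m F (B ** ?e t) + dis m F (?e (- t))"
    by (rule dis_mult[OF F B])
  finally show ?case using col_op.IH[OF col_op.prems] d[OF col_op.hyps(2), of "- t"] unfolding of_nat_Suc distrib_right by linarith
qed

text \<open>With a third index \<open>b\<close>, the matrices differing from 1 only in the entries
  \<open>(a,c)\<close> and \<open>(b,c)\<close> form a copy of \<open>Z^2\<close> normalised by
  \<open>elem a b 1\<close> and \<open>elem b a 1\<close>. All four generators of this affine group
  are some \<open>elem k l 1\<close>, so \<open>relative_T\<close> applies; 12 comes from
  \<open>124 <= 12^2\<close>.\<close>

lemma dis_elem_1_imp: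
  fixes F :: "int^'n^'n \<Rightarrow> real"
  assumes F: "mod_periodic m F" and m: "m = 2 * h + 1" "h \<ge> 0" and ac: "a \<noteq> c"
    and d: "\<And>k l. k \<noteq> l \<Longrightarrow> dis m F (elem k l 1) \<le> d"
  shows "dis m F (elem a c t) \<le> 12 * d"
proof -
  obtain b where b: "b \<noteq> a" "b \<noteq> c" using three_indices[OF dim3] .
  note ne = ac ac[symmetric] b b[symmetric]
  define v :: "int \<Rightarrow> int \<Rightarrow> int^'n^'n" where "v s t = elem a c s ** elem b c t" for s t
  have v_nth: "(A ** v s t) $ i $ j = A $ i $ j + (if j = c then A $ i $ a * s + A $ i $ b * t else 0)" for A s t i j
    using ne by (auto simp: v_def matrix_mul_assoc mult_elem_nth)
  have v_SL: "v s t \<in> SL_int" for s t using ne by (simp add: v_def SL_int_mult elem_in_SL)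
  have v_add: "A ** v s' t' ** v s t = A ** v (s + s') (t + t')" for s t s' t' and A :: "int^'n^'n"
    using ne by (auto simp: vec_eq_iff v_nth algebra_simps)
  have v_u: "A ** v s t ** elem a b 1 = A ** elem a b 1 ** v (s - t) t" for s t and A :: "int^'n^'n"
    using ne by (auto simp: vec_eq_iff v_nth mult_elem_nth algebra_simps)
  have v_l: "A ** v s t ** elem b a 1 = A ** elem b a 1 ** v s (t - s)" for s t and A :: "int^'n^'n"
    using ne by (auto simp: vec_eq_iff v_nth mult_elem_nth algebra_simps)
  have v_per: "mmod m (v (s + m) t) = mmod m (v s t)" "mmod m (v s (t + m)) = mmod m (v s t)" for s t
    unfolding v_def by (intro mmod_mult_cong elem_cong; simp add: cong_def)+
  define T where "T s t A = mmod m (A ** v s t)" for s t and A :: "int^'n^'n"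
  interpret torus_action "SL_mod m" h T
  proof
    show "finite (SL_mod m :: (int^'n^'n) set)" using m by (intro finite_SL_mod) auto
    show "0 \<le> h" by fact
    show "bij_betw (T s t) (SL_mod m) (SL_mod m)" for s t
      unfolding T_def by (rule bij_SL_mod_right[OF v_SL])
    show "T s t (T s' t' A) = T (s + s') (t + t') A" for s t s' t' A
      by (simp add: T_def v_add)
    show "T (s + (2 * h + 1)) t A = T s t A" "T s (t + (2 * h + 1)) A = T s t A" for s t A
      unfolding T_def m(1)[symmetric] by (metis mmod_mult_right v_per)+
  qed
  let ?f = "\<lambda>A. complex_of_real (F A)"
  have nsq: "nsq (\<lambda>A. ?f (mmod m (A ** g)) - ?f A) = (dis m F g)\<^sup>2" for g
    by (simp add: nsq_def dis_power2 mod_periodicD[OF F] of_real_diff[symmetric] norm_of_real del: of_real_diff)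
  have v10: "v 1 0 = elem a c 1" "v 0 1 = elem b c 1" "v t 0 = elem a c t" by (simp_all add: v_def)
  have sq: "(dis m F (elem k l 1))\<^sup>2 \<le> d\<^sup>2" if "k \<noteq> l" for k l
    using d[OF that] dis_nonneg by (rule power_mono)
  have "nsq (\<lambda>A. ?f (T t 0 A) - ?f A) \<le> 124 * d\<^sup>2"
  proof (rule relative_T)
    show "bij_betw (\<lambda>A. mmod m (A ** elem a b 1)) (SL_mod m) (SL_mod m)"
      "bij_betw (\<lambda>A. mmod m (A ** elem b a 1)) (SL_mod m) (SL_mod m)"
      using ne by (intro bij_SL_mod_right elem_in_SL; simp)+
    show "mmod m (T s t A ** elem a b 1) = T (s - t) t (mmod m (A ** elem a b 1))"
      "mmod m (T s t A ** elem b a 1) = T s (t - s) (mmod m (A ** elem b a 1))" for s t A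
      by (simp_all add: T_def v_u v_l)
    show "nsq (\<lambda>A. ?f (T 1 0 A) - ?f A) \<le> d\<^sup>2" "nsq (\<lambda>A. ?f (T 0 1 A) - ?f A) \<le> d\<^sup>2"
      unfolding T_def nsq v10 using ne by (intro sq; simp)+
    show "nsq (\<lambda>A. ?f (mmod m (A ** elem a b 1)) - ?f A) \<le> d\<^sup>2" "nsq (\<lambda>A. ?f (mmod m (A ** elem b a 1)) - ?f A) \<le> d\<^sup>2"
      unfolding nsq using ne by (intro sq; simp)+
  qed
  then have "(dis m F (elem a c t))\<^sup>2 \<le> 124 * d\<^sup>2" by (simp add: T_def nsq v10)
  also have "\<dots> \<le> (12 * d)\<^sup>2" by (simp add: power_mult_distrib)
  finally show ?thesis
    by (rule power2_le_imp_le) (use order_trans[OF dis_nonneg d[OF ac]] in simp)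
qed

text \<open>Each \<open>elem k l 1\<close> is a commutator, and a word and its inverse have equal length.\<close>
lemma elem_even_word:
  assumes "k \<noteq> l"
  shows "\<exists>r w. set w \<subseteq> S \<and> length w = 2 * r \<and> word_prod w = elem k l 1"
proof -
  obtain b where b: "b \<noteq> k" "b \<noteq> l" using three_indices[OF dim3] .
  have w: "\<exists>u u'. set u \<subseteq> S \<and> set u' \<subseteq> S \<and> length u' = length u \<and> word_prod u = elem i j 1 \<and> word_prod u' = elem i j (-1)"
    if ij: "i \<noteq> j" for i j
  proof -
    obtain u u' where u: "set u \<subseteq> S" "set u' \<subseteq> S" "length u' = length u" "word_prod u = elem i j 1" "elem i j 1 ** word_prod u' = mat 1"
      using SL_int_word[OF elem_in_SL[OF ij, of 1]] by blast
    have "word_prod u' = elem i j (-1) ** (elem i j 1 ** word_prod u')"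
      using elem_inverse(2)[OF ij, of 1] by (simp add: matrix_mul_assoc)
    then show ?thesis using u by auto
  qed
  obtain u u' where u: "set u \<subseteq> S" "set u' \<subseteq> S" "length u' = length u" "word_prod u = elem k b 1" "word_prod u' = elem k b (-1)"
    using w[of k b] b by auto
  obtain v v' where v: "set v \<subseteq> S" "set v' \<subseteq> S" "length v' = length v" "word_prod v = elem b l 1" "word_prod v' = elem b l (-1)"
    using w[of b l] b by auto
  have "word_prod (u @ v @ u' @ v') = elem k b 1 ** elem b l 1 ** elem k b (-1) ** elem b l (-1)"
    using u v by (simp add: word_prod_append matrix_mul_assoc)
  also have "\<dots> = elem k l 1"
    using b assms by (auto simp: vec_eq_iff mult_elem_nth elem_nth)
  finally have "word_prod (u @ v @ u' @ v') = elem k l 1" .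
  then show ?thesis using u v
    by (intro exI[of _ "length u + length v"] exI[of _ "u @ v @ u' @ v'"]) auto
qed

end

section \<open>The walk operator and its norm on mean-zero functions\<close>

context sl_generators
begin

definition step_op :: "(int^'n^'n \<Rightarrow> real) \<Rightarrow> int^'n^'n \<Rightarrow> real" where
  "step_op F A = (\<Sum>s\<in>S. F (A ** s))"

lemma step_op_periodic:
  assumes "mod_periodic m F" shows "mod_periodic m (step_op F)"
proof -
  have "F (mmod m A ** s) = F (A ** s)" for A s
    using mod_periodicD[OF mod_periodic_right[OF assms]] .
  then show ?thesis by (simp add: mod_periodic_def step_op_def)
qed

lemma sum_step_op:
  assumes "mod_periodic m F"
  shows "(\<Sum>A\<in>SL_mod m. step_op F A) = real (card S) * (\<Sum>A\<in>SL_mod m. F A)"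
proof -
  have "(\<Sum>A\<in>SL_mod m. step_op F A) = (\<Sum>s\<in>S. \<Sum>A\<in>SL_mod m. F (A ** s))"
    unfolding step_op_def by (rule sum.swap)
  also have "\<dots> = (\<Sum>s\<in>S. \<Sum>A\<in>SL_mod m. F A)"
    using S_SL by (intro sum.cong sum_mult_right assms) auto
  finally show ?thesis by simp
qed

text \<open>Inversion is an involution of \<open>S\<close>, and translating \<open>A\<close> by the
  inverse of \<open>s\<close> moves \<open>s\<close> from one factor to the other.\<close>

lemma step_op_self_adjoint:
  assumes F: "mod_periodic m F" and G: "mod_periodic m G"
  shows "(\<Sum>A\<in>SL_mod m. F A * step_op G A) = (\<Sum>A\<in>SL_mod m. step_op F A * G A)"
proof -
  have "\<forall>s\<in>S. \<exists>t. t \<in> S \<and> s ** t = mat 1 \<and> t ** s = mat 1" using S_inverse by blast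
  from bchoice[OF this] obtain iv where iv: "\<And>s. s \<in> S \<Longrightarrow> iv s \<in> S" "\<And>s. s \<in> S \<Longrightarrow> s ** iv s = mat 1" "\<And>s. s \<in> S \<Longrightarrow> iv s ** s = mat 1"
    by blast
  have iv_iv: "iv (iv s) = s" if "s \<in> S" for s
  proof -
    have "iv (iv s) = (s ** iv s) ** iv (iv s)" by (simp add: iv that)
    also have "\<dots> = s" using iv(1)[OF that] by (simp add: iv matrix_mul_assoc[symmetric])
    finally show ?thesis .
  qed
  have bij: "bij_betw iv S S"
    by (rule bij_betw_byWitness[where f' = iv]) (auto simp: iv_iv iv)
  have "(\<Sum>A\<in>SL_mod m. F A * step_op G A) = (\<Sum>s\<in>S. \<Sum>A\<in>SL_mod m. F A * G (A ** s))"
    unfolding step_op_def sum_distrib_left by (rule sum.swap)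
  also have "\<dots> = (\<Sum>s\<in>S. \<Sum>A\<in>SL_mod m. F (A ** iv s) * G A)"
  proof (rule sum.cong[OF refl])
    fix s assume s: "s \<in> S"
    have per: "mod_periodic m (\<lambda>A. F A * G (A ** s))"
      using F mod_periodic_right[OF G, of s] by (simp add: mod_periodic_def)
    have "iv s \<in> SL_int" using iv(1)[OF s] S_SL by blast
    from sum_mult_right[OF per this]
    show "(\<Sum>A\<in>SL_mod m. F A * G (A ** s)) = (\<Sum>A\<in>SL_mod m. F (A ** iv s) * G A)"
      by (simp add: matrix_mul_assoc[symmetric] iv s)
  qed
  also have "\<dots> = (\<Sum>s\<in>S. \<Sum>A\<in>SL_mod m. F (A ** s) * G A)"
    by (rule sum.reindex_bij_betw[OF bij, where g = "\<lambda>s. \<Sum>A\<in>SL_mod m. F (A ** s) * G A"])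
  also have "\<dots> = (\<Sum>A\<in>SL_mod m. step_op F A * G A)"
    unfolding step_op_def sum_distrib_right by (rule sum.swap)
  finally show ?thesis .
qed

text \<open>Each squared displacement is twice the squared norm minus twice a correlation. Summed
  over pairs, the correlations give \<open><F, P (P F)>\<close> for \<open>P = step_op\<close>,
  which is \<open>|P F|^2\<close> by self-adjointness. So a large \<open>P F\<close> forces small
  displacements by all products of two generators.\<close>

lemma sum_dis_pairs:
  assumes F: "mod_periodic m F"
  shows "(\<Sum>s\<in>S. \<Sum>t\<in>S. (dis m F (s ** t))\<^sup>2)
    = 2 * ((real (card S))\<^sup>2 * (\<Sum>A\<in>SL_mod m. (F A)\<^sup>2) - (\<Sum>A\<in>SL_mod m. (step_op F A)\<^sup>2))"
proof -
  let ?n = "\<Sum>A\<in>SL_mod m. (F A)\<^sup>2"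
  have F2: "mod_periodic m (\<lambda>A. (F A)\<^sup>2)" using F by (simp add: mod_periodic_def)
  have "(dis m F (s ** t))\<^sup>2 = 2 * ?n - 2 * (\<Sum>A\<in>SL_mod m. F A * F (A ** s ** t))" if "s \<in> S" "t \<in> S" for s t
  proof -
    have "s ** t \<in> SL_int" using that S_SL by (auto intro: SL_int_mult)
    then have "(\<Sum>A\<in>SL_mod m. (F (A ** s ** t))\<^sup>2) = ?n"
      using sum_mult_right[OF F2, of "s ** t"] by (simp add: matrix_mul_assoc)
    then show ?thesis
      by (simp add: dis_power2 power2_diff sum.distrib sum_subtractf matrix_mul_assoc sum_distrib_left mult_ac)
  qed
  then have "(\<Sum>s\<in>S. \<Sum>t\<in>S. (dis m F (s ** t))\<^sup>2) = (\<Sum>s\<in>S. \<Sum>t\<in>S. 2 * ?n - 2 * (\<Sum>A\<in>SL_mod m. F A * F (A ** s ** t)))"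
    by (intro sum.cong refl) auto
  also have "\<dots> = 2 * (real (card S))\<^sup>2 * ?n - 2 * (\<Sum>s\<in>S. \<Sum>t\<in>S. \<Sum>A\<in>SL_mod m. F A * F (A ** s ** t))"
    by (simp add: sum_subtractf sum_distrib_left[symmetric] power2_eq_square)
  also have "(\<Sum>s\<in>S. \<Sum>t\<in>S. \<Sum>A\<in>SL_mod m. F A * F (A ** s ** t)) = (\<Sum>A\<in>SL_mod m. F A * step_op (step_op F) A)"
    unfolding step_op_def sum_distrib_left by (rule sum_rotate3[symmetric])
  also have "\<dots> = (\<Sum>A\<in>SL_mod m. (step_op F A)\<^sup>2)"
    using step_op_self_adjoint[OF F step_op_periodic[OF F]] by (simp add: power2_eq_square)
  finally show ?thesis by (simp add: algebra_simps)
qed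

lemma dis_even_word:
  assumes F: "mod_periodic m F" and d: "\<And>s t. s \<in> S \<Longrightarrow> t \<in> S \<Longrightarrow> dis m F (s ** t) \<le> d"
  shows "set w \<subseteq> S \<Longrightarrow> length w = 2 * r \<Longrightarrow> dis m F (word_prod w) \<le> real r * d"
proof (induction r arbitrary: w)
  case (Suc r)
  then obtain s t v where w: "w = s # t # v" "length v = 2 * r"
    by (auto simp: numeral_2_eq_2 length_Suc_conv)
  have st: "s \<in> S" "t \<in> S" and v: "set v \<subseteq> S" using Suc w by auto
  have "s ** t \<in> SL_int" using st S_SL by (auto intro: SL_int_mult)
  then have "dis m F ((s ** t) ** word_prod v) \<le> dis m F (s ** t) + dis m F (word_prod v)"
    by (rule dis_mult[OF F])
  also have "\<dots> \<le> d + real r * d" using d[OF st] Suc.IH[OF v w(2)] by linarith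
  finally show ?case by (simp add: w matrix_mul_assoc distrib_right)
qed simp

text \<open>In the expanded square the cross term sums over \<open>g\<close> to a multiple of the
  total of \<open>F\<close>, hence vanishes. A mean-zero function is thus far from invariant under
  some group element.\<close>

lemma sum_dis_all:
  fixes F :: "int^'n^'n \<Rightarrow> real"
  assumes m: "m > 0" and F: "mod_periodic m F" and zero: "(\<Sum>A\<in>SL_mod m. F A) = 0"
  shows "(\<Sum>g\<in>SL_mod m. (dis m F g)\<^sup>2) = 2 * real (card (SL_mod m :: (int^'n^'n) set)) * (\<Sum>A\<in>SL_mod m. (F A)\<^sup>2)"
proof -
  let ?X = "SL_mod m :: (int^'n^'n) set" and ?n = "\<Sum>A\<in>SL_mod m. (F A)\<^sup>2"
  have F2: "mod_periodic m (\<lambda>A. (F A)\<^sup>2)" using F by (simp add: mod_periodic_def)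
  have shift: "(\<Sum>g\<in>?X. G (A ** g)) = (\<Sum>g\<in>?X. G g)" if G: "mod_periodic m G" and A: "A \<in> ?X" for G :: "int^'n^'n \<Rightarrow> real" and A
  proof -
    obtain B where B: "B \<in> SL_int" "A = mmod m B" using A by (auto simp: SL_mod_def)
    have "G (A ** g) = G (B ** g)" for g by (rule mod_periodic_eq[OF G]) (simp add: B)
    then show ?thesis using sum_mult_left[OF G B(1)] by simp
  qed
  have "(\<Sum>g\<in>?X. (dis m F g)\<^sup>2) = (\<Sum>A\<in>?X. \<Sum>g\<in>?X. (F (A ** g) - F A)\<^sup>2)"
    unfolding dis_power2 by (rule sum.swap)
  also have "\<dots> = (\<Sum>A\<in>?X. ?n + real (card ?X) * (F A)\<^sup>2)"
  proof (rule sum.cong[OF refl])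
    fix A assume A: "A \<in> ?X"
    have "(\<Sum>g\<in>?X. (F (A ** g) - F A)\<^sup>2) = (\<Sum>g\<in>?X. (F (A ** g))\<^sup>2) - 2 * F A * (\<Sum>g\<in>?X. F (A ** g)) + real (card ?X) * (F A)\<^sup>2"
      by (simp add: power2_diff sum.distrib sum_subtractf sum_distrib_left mult_ac)
    also have "\<dots> = ?n + real (card ?X) * (F A)\<^sup>2"
      using shift[OF F A] shift[OF F2 A] zero by simp
    finally show "(\<Sum>g\<in>?X. (F (A ** g) - F A)\<^sup>2) = \<dots>" .
  qed
  also have "\<dots> = 2 * real (card ?X) * ?n" by (simp add: sum.distrib sum_distrib_left[symmetric])
  finally show ?thesis .
qed

text \<open>Pairs of steps are used so that no eigenvalue near \<open>-1\<close> can occur.\<close>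
theorem spectral_gap:
  obtains \<rho> where "0 < \<rho>" "\<rho> < 1"
    "\<And>p q F. prime p \<Longrightarrow> prime q \<Longrightarrow> p \<noteq> q \<Longrightarrow> odd (p * q) \<Longrightarrow> mod_periodic (p * q) F \<Longrightarrow>
      (\<Sum>A\<in>SL_mod (p * q). F A) = 0 \<Longrightarrow>
      (\<Sum>A\<in>SL_mod (p * q). (step_op F A)\<^sup>2) \<le> \<rho> * (real (card S))\<^sup>2 * (\<Sum>A\<in>SL_mod (p * q). (F A)\<^sup>2)"
proof -
  have "\<forall>z\<in>{(k::'n,l). k \<noteq> l}. \<exists>r. \<exists>w. set w \<subseteq> S \<and> length w = 2 * r \<and> word_prod w = elem (fst z) (snd z) 1"
    using elem_even_word by auto
  from bchoice[OF this] obtain r where r: "\<And>k l. k \<noteq> l \<Longrightarrow> \<exists>w. set w \<subseteq> S \<and> length w = 2 * r (k, l) \<and> word_prod w = elem k l 1"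
    by auto
  define L where "L = (\<Sum>z\<in>UNIV. r z)"
  define c where "c = 2 * (CARD('n) * (2 + 2 * CARD('n)))"
  \<comment> \<open>An element takes at most \<open>c\<close> elementary operations, each costs at
    most 12 times the bound for the matrices \<open>elem k l 1\<close>, and each of these takes at
    most \<open>L\<close> pairs of generators. The summand 1 ensures \<open>M >= 1\<close>.\<close>
  define M where "M = 1 + real c * (12 * real L)"
  have M: "M \<ge> 1" by (simp add: M_def)
  have S0: "S \<noteq> {}"
  proof
    assume S: "S = {}"
    obtain k l :: 'n where kl: "k \<noteq> l" using three_indices[OF dim3, of undefined undefined] by metis
    then obtain w where "set w \<subseteq> S" "word_prod w = elem k l 1" using r by blast
    then have "elem k l 1 = (mat 1 :: int^'n^'n)" using S by auto
    then have "elem k l 1 $ k $ l = (mat 1 :: int^'n^'n) $ k $ l" by simp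
    then show False using kl by (simp add: elem_nth mat_def)
  qed
  then have cS: "real (card S) \<ge> 1" using finite_S by (simp add: Suc_le_eq card_gt_0_iff)
  \<comment> \<open>The argument below yields the factor \<open>1 - 1 / (M * card S)^2\<close>; the
    extra 2 keeps \<open>\<rho>\<close> positive even when \<open>M * card S = 1\<close>.\<close>
  define \<rho> where "\<rho> = 1 - 1 / (2 * M\<^sup>2 * (real (card S))\<^sup>2)"
  have MS: "1 \<le> M\<^sup>2 * (real (card S))\<^sup>2"
    using mult_mono[of 1 "M\<^sup>2" 1 "(real (card S))\<^sup>2"] M cS by (simp add: one_le_power)
  show thesis
  proof
    show "0 < \<rho>" "\<rho> < 1" using MS by (auto simp: \<rho>_def field_simps)
    fix p q :: int and F :: "int^'n^'n \<Rightarrow> real"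
    assume p: "prime p" and q: "prime q" and ne: "p \<noteq> q" and odd: "odd (p * q)" and F: "mod_periodic (p * q) F"
      and zero: "(\<Sum>A\<in>SL_mod (p * q). F A) = 0"
    let ?m = "p * q"
    let ?X = "SL_mod ?m :: (int^'n^'n) set"
    have m: "?m > 0" using p q by (simp add: prime_gt_0_int)
    have finX: "finite ?X" by (rule finite_SL_mod[OF m])
    obtain h where h: "?m = 2 * h + 1" using odd by (rule oddE)
    then have h0: "h \<ge> 0" using m by linarith
    define E where "E = (\<Sum>s\<in>S. \<Sum>t\<in>S. (dis ?m F (s ** t))\<^sup>2)"
    define d where "d = sqrt E"
    have E0: "E \<ge> 0" unfolding E_def by (intro sum_nonneg) auto
    then have d0: "d \<ge> 0" by (simp add: d_def)
    have pair: "dis ?m F (s ** t) \<le> d" if "s \<in> S" "t \<in> S" for s t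
    proof -
      have "(dis ?m F (s ** t))\<^sup>2 \<le> (\<Sum>t\<in>S. (dis ?m F (s ** t))\<^sup>2)"
        by (rule member_le_sum) (use that finite_S in auto)
      also have "\<dots> \<le> E" unfolding E_def
        by (rule member_le_sum[of s S "\<lambda>s. \<Sum>t\<in>S. (dis ?m F (s ** t))\<^sup>2"]) (use that finite_S in \<open>auto intro: sum_nonneg\<close>)
      finally show ?thesis unfolding d_def by (rule real_le_rsqrt)
    qed
    have e1: "dis ?m F (elem k l 1) \<le> real L * d" if "k \<noteq> l" for k l
    proof -
      obtain w where "set w \<subseteq> S" "length w = 2 * r (k, l)" "word_prod w = elem k l 1" using r[OF \<open>k \<noteq> l\<close>] by blast
      then have "dis ?m F (elem k l 1) \<le> real (r (k, l)) * d"
        using dis_even_word[OF F pair] by metis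
      also have "\<dots> \<le> real L * d"
        using d0 by (intro mult_right_mono) (auto simp: L_def intro: member_le_sum)
      finally show ?thesis .
    qed
    have e: "dis ?m F (elem k l t) \<le> 12 * (real L * d)" if "k \<noteq> l" for k l t
      by (rule dis_elem_1_imp[OF F h h0 that e1])
    have all: "dis ?m F g \<le> M * d" if "g \<in> ?X" for g
    proof -
      obtain B where B: "B \<in> SL_int" "g = mmod ?m B" using \<open>g \<in> ?X\<close> by (auto simp: SL_mod_def)
      obtain C where C: "reach 1 c B C" "mmod ?m C = mmod ?m (mat 1)"
        using bounded_elementary_generation[OF p q ne B(1)] unfolding c_def by blast
      have "dis ?m F g = dis ?m F B" by (rule dis_cong[OF F]) (simp add: B)
      also have "\<dots> \<le> real c * (12 * (real L * d)) + dis ?m F C"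
        by (rule dis_reach[OF F e B(1) C(1)])
      also have "dis ?m F C = 0" using dis_cong[OF F C(2)] by simp
      finally show ?thesis using d0 by (simp add: M_def algebra_simps)
    qed
    have "2 * real (card ?X) * (\<Sum>A\<in>?X. (F A)\<^sup>2) = (\<Sum>g\<in>?X. (dis ?m F g)\<^sup>2)"
      by (rule sum_dis_all[OF m F zero, symmetric])
    also have "\<dots> \<le> (\<Sum>g\<in>?X. (M * d)\<^sup>2)"
      by (intro sum_mono power_mono all dis_nonneg)
    finally have "real (card ?X) * (2 * (\<Sum>A\<in>?X. (F A)\<^sup>2)) \<le> real (card ?X) * (M * d)\<^sup>2" by simp
    moreover have "card ?X > 0" using SL_mod_one finX by (auto simp: card_gt_0_iff)
    ultimately have "2 * (\<Sum>A\<in>?X. (F A)\<^sup>2) \<le> (M * d)\<^sup>2" by simp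
    also have "\<dots> = M\<^sup>2 * E" using E0 by (simp add: power_mult_distrib d_def)
    also have "E = 2 * ((real (card S))\<^sup>2 * (\<Sum>A\<in>?X. (F A)\<^sup>2) - (\<Sum>A\<in>?X. (step_op F A)\<^sup>2))"
      unfolding E_def by (rule sum_dis_pairs[OF F])
    finally have "(\<Sum>A\<in>?X. (F A)\<^sup>2) \<le> M\<^sup>2 * ((real (card S))\<^sup>2 * (\<Sum>A\<in>?X. (F A)\<^sup>2) - (\<Sum>A\<in>?X. (step_op F A)\<^sup>2))"
      unfolding mult.left_commute[of _ 2] by simp
    then have "(\<Sum>A\<in>?X. (F A)\<^sup>2) / M\<^sup>2 \<le> (real (card S))\<^sup>2 * (\<Sum>A\<in>?X. (F A)\<^sup>2) - (\<Sum>A\<in>?X. (step_op F A)\<^sup>2)"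
      using M by (simp add: field_simps)
    moreover have "\<rho> * (real (card S))\<^sup>2 = (real (card S))\<^sup>2 - 1 / (2 * M\<^sup>2)"
      using M cS by (simp add: \<rho>_def field_simps)
    moreover have "(\<Sum>A\<in>?X. (F A)\<^sup>2) / (2 * M\<^sup>2) \<le> (\<Sum>A\<in>?X. (F A)\<^sup>2) / M\<^sup>2"
      using M by (intro divide_left_mono sum_nonneg) auto
    ultimately show "(\<Sum>A\<in>?X. (step_op F A)\<^sup>2) \<le> \<rho> * (real (card S))\<^sup>2 * (\<Sum>A\<in>?X. (F A)\<^sup>2)"
      by (simp add: left_diff_distrib)
  qed
qed

section \<open>Words, iterates of the walk operator and equidistribution\<close>

definition words :: "nat \<Rightarrow> (int^'n^'n) list set" where
  "words N = {w. length w = N \<and> set w \<subseteq> S}"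

lemma finite_words: "finite (words N)" and card_words: "card (words N) = card S ^ N"
  using finite_lists_length_eq[OF finite_S, of N] card_lists_length_eq[OF finite_S, of N]
  by (simp_all add: words_def conj_commute)

definition walk :: "nat \<Rightarrow> (int^'n^'n \<Rightarrow> real) \<Rightarrow> int^'n^'n \<Rightarrow> real" where
  "walk N F A = (\<Sum>w\<in>words N. F (A ** word_prod w))"

lemma walk_0: "walk 0 F = F"
proof -
  have "words 0 = {[]}" by (auto simp: words_def)
  then show ?thesis by (simp add: walk_def fun_eq_iff)
qed

lemma walk_Suc: "walk (Suc N) F = step_op (walk N F)"
proof
  fix A
  have "words (Suc N) = (\<lambda>(s, w). s # w) ` (S \<times> words N)"
    by (auto simp: words_def length_Suc_conv image_iff)
  then have "walk (Suc N) F A = (\<Sum>(s, w)\<in>S \<times> words N. F (A ** (s ** word_prod w)))"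
    unfolding walk_def by (simp add: sum.reindex inj_on_def case_prod_beta)
  also have "\<dots> = step_op (walk N F) A"
    by (simp add: step_op_def walk_def sum.cartesian_product matrix_mul_assoc)
  finally show "walk (Suc N) F A = step_op (walk N F) A" .
qed

text \<open>Subtract the mean and iterate the gap; the value of the iterate at the identity is at
  most its \<open>L2\<close> norm. The rate is \<open>sqrt \<rho>\<close>, as the gap concerns
  squared norms, and the remaining factor bounds the norm of \<open>F - \<mu>\<close>, a function of
  size at most 2 on at most \<open>(p q)^(n^2)\<close> points.\<close>

theorem equidistribution:
  obtains r where "0 < r" "r < 1"
    "\<And>p q N F. prime p \<Longrightarrow> prime q \<Longrightarrow> p \<noteq> q \<Longrightarrow> odd (p * q) \<Longrightarrow> mod_periodic (p * q) F \<Longrightarrow> (\<And>A. \<bar>F A\<bar> \<le> 1) \<Longrightarrow>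
      (\<Sum>w\<in>words N. F (word_prod w)) \<le> real (card S) ^ N *
        ((\<Sum>A\<in>SL_mod (p * q). F A) / real (card (SL_mod (p * q) :: (int^'n^'n) set))
          + 2 * r ^ N * sqrt (of_int (p * q) ^ (CARD('n) * CARD('n))))"
proof (rule spectral_gap)
  fix \<rho> assume \<rho>: "0 < \<rho>" "\<rho> < 1" and gap:
    "\<And>p q F. prime p \<Longrightarrow> prime q \<Longrightarrow> p \<noteq> q \<Longrightarrow> odd (p * q) \<Longrightarrow> mod_periodic (p * q) F \<Longrightarrow>
      (\<Sum>A\<in>SL_mod (p * q). F A) = 0 \<Longrightarrow>
      (\<Sum>A\<in>SL_mod (p * q). (step_op F A)\<^sup>2) \<le> \<rho> * (real (card S))\<^sup>2 * (\<Sum>A\<in>SL_mod (p * q). (F A)\<^sup>2)"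
  show thesis
  proof
    show "0 < sqrt \<rho>" "sqrt \<rho> < 1" using \<rho> by auto
    fix p q :: int and N and F :: "int^'n^'n \<Rightarrow> real"
    assume pq: "prime p" "prime q" "p \<noteq> q" "odd (p * q)" and F: "mod_periodic (p * q) F" and bd: "\<And>A. \<bar>F A\<bar> \<le> 1"
    let ?m = "p * q"
    let ?X = "SL_mod ?m :: (int^'n^'n) set"
    have m: "?m > 0" using pq by (simp add: prime_gt_0_int)
    have finX: "finite ?X" by (rule finite_SL_mod[OF m])
    have cX: "card ?X > 0" using SL_mod_one finX by (auto simp: card_gt_0_iff)
    define \<mu> where "\<mu> = (\<Sum>A\<in>?X. F A) / real (card ?X)"
    define G where "G A = F A - \<mu>" for A
    have \<mu>: "\<bar>\<mu>\<bar> \<le> 1"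
    proof -
      have "\<bar>\<Sum>A\<in>?X. F A\<bar> \<le> (\<Sum>A\<in>?X. 1)" using bd by (intro sum_abs[THEN order_trans] sum_mono)
      then show ?thesis using cX by (simp add: \<mu>_def)
    qed
    have G: "mod_periodic ?m G" using F by (simp add: mod_periodic_def G_def)
    have zero: "(\<Sum>A\<in>?X. G A) = 0" using cX by (simp add: G_def sum_subtractf \<mu>_def)
    have iter: "mod_periodic ?m (walk k G) \<and> (\<Sum>A\<in>?X. walk k G A) = 0 \<and>
        (\<Sum>A\<in>?X. (walk k G A)\<^sup>2) \<le> (\<rho> * (real (card S))\<^sup>2) ^ k * (\<Sum>A\<in>?X. (G A)\<^sup>2)" for k
    proof (induction k)
      case 0
      show ?case using G zero by (simp add: walk_0)
    next
      case (Suc k)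
      then have IH: "mod_periodic ?m (walk k G)" "(\<Sum>A\<in>?X. walk k G A) = 0"
        "(\<Sum>A\<in>?X. (walk k G A)\<^sup>2) \<le> (\<rho> * (real (card S))\<^sup>2) ^ k * (\<Sum>A\<in>?X. (G A)\<^sup>2)" by auto
      have "(\<Sum>A\<in>?X. (walk (Suc k) G A)\<^sup>2) \<le> \<rho> * (real (card S))\<^sup>2 * (\<Sum>A\<in>?X. (walk k G A)\<^sup>2)"
        unfolding walk_Suc by (rule gap[OF pq IH(1,2)])
      also have "\<dots> \<le> \<rho> * (real (card S))\<^sup>2 * ((\<rho> * (real (card S))\<^sup>2) ^ k * (\<Sum>A\<in>?X. (G A)\<^sup>2))"
        using \<rho> by (intro mult_left_mono IH(3)) auto
      finally show ?case
        using step_op_periodic[OF IH(1)] sum_step_op[OF IH(1)] IH(2) by (simp add: walk_Suc mult.assoc)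
    qed
    have G4: "(G A)\<^sup>2 \<le> 4" for A
    proof -
      have "\<bar>G A\<bar> \<le> 2" using bd[of A] \<mu> unfolding G_def by linarith
      then have "\<bar>G A\<bar>\<^sup>2 \<le> 2\<^sup>2" by (intro power_mono) auto
      then show ?thesis by simp
    qed
    have cXm: "real (card ?X) \<le> of_int ?m ^ (CARD('n) * CARD('n))"
    proof -
      have "real (card ?X) \<le> real (nat ?m ^ (CARD('n) * CARD('n)))"
        using card_SL_mod_le[OF m] by (simp only: of_nat_le_iff)
      also have "\<dots> = of_int ?m ^ (CARD('n) * CARD('n))" using m by simp
      finally show ?thesis .
    qed
    have "(walk N G (mmod ?m (mat 1)))\<^sup>2 \<le> (\<Sum>A\<in>?X. (walk N G A)\<^sup>2)"
      by (rule member_le_sum[of _ ?X "\<lambda>A. (walk N G A)\<^sup>2"]) (use finX SL_mod_one in auto)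
    also have "\<dots> \<le> (\<rho> * (real (card S))\<^sup>2) ^ N * (\<Sum>A\<in>?X. (G A)\<^sup>2)" using iter by blast
    also have "\<dots> \<le> (\<rho> * (real (card S))\<^sup>2) ^ N * (4 * of_int ?m ^ (CARD('n) * CARD('n)))"
    proof (intro mult_left_mono)
      have "(\<Sum>A\<in>?X. (G A)\<^sup>2) \<le> (\<Sum>A\<in>?X. 4)" by (intro sum_mono G4)
      then show "(\<Sum>A\<in>?X. (G A)\<^sup>2) \<le> 4 * of_int ?m ^ (CARD('n) * CARD('n))" using cXm by simp
    qed (use \<rho> in auto)
    also have "\<dots> = (real (card S) ^ N * (2 * sqrt \<rho> ^ N * sqrt (of_int ?m ^ (CARD('n) * CARD('n)))))\<^sup>2"
    proof -
      define y :: real where "y = of_int ?m ^ (CARD('n) * CARD('n))"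
      have "y \<ge> 0" using m by (simp add: y_def del: of_int_mult)
      then show ?thesis unfolding y_def[symmetric] using \<rho>
        by (simp add: power_mult_distrib power_mult[symmetric] mult.commute[of _ 2]) (simp add: power_mult)
    qed
    finally have "walk N G (mmod ?m (mat 1)) \<le> real (card S) ^ N * (2 * sqrt \<rho> ^ N * sqrt (of_int ?m ^ (CARD('n) * CARD('n))))"
      by (rule power2_le_imp_le) (use \<rho> m in \<open>intro mult_nonneg_nonneg real_sqrt_ge_zero zero_le_power; simp del: of_int_mult\<close>)
    also have "walk N G (mmod ?m (mat 1)) = walk N G (mat 1)" using iter[of N] by (simp add: mod_periodic_def)
    also have "\<dots> = (\<Sum>w\<in>words N. F (word_prod w)) - real (card S) ^ N * \<mu>"
      by (simp add: walk_def G_def sum_subtractf card_words)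
    finally show "(\<Sum>w\<in>words N. F (word_prod w)) \<le> real (card S) ^ N *
        ((\<Sum>A\<in>?X. F A) / real (card ?X) + 2 * sqrt \<rho> ^ N * sqrt (of_int ?m ^ (CARD('n) * CARD('n))))"
      by (simp add: \<mu>_def distrib_left)
  qed
qed

end

section \<open>Many primes between \<open>K\<close> and \<open>K\<^sup>2\<close>\<close>

text \<open>The numbers \<open>1 / (k * (n choose k))\<close> form Leibniz's harmonic triangle, in
  which each entry is a difference of two neighbours.\<close>

lemma leibniz_triangle:
  assumes "1 \<le> k" "Suc k \<le> n"
  shows "1 / (real (Suc k) * real (n choose Suc k)) = 1 / (real k * real (n - 1 choose k)) - 1 / (real k * real (n choose k))"
proof -
  have n: "n = Suc (n - 1)" using assms by simp
  have 1: "Suc k * (n choose Suc k) = n * (n - 1 choose k)"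
    using Suc_times_binomial_eq[of "n - 1" k] n by (metis mult.commute)
  have 2: "(n - k) * (n choose k) = n * (n - 1 choose k)"
    by (rule binomial_absorb_comp)
  have r1: "real (Suc k) * real (n choose Suc k) = real n * real (n - 1 choose k)"
    using 1 by (metis of_nat_mult)
  have r2: "(real n - real k) * real (n choose k) = real n * real (n - 1 choose k)"
    using 2 assms by (metis Suc_leD of_nat_diff of_nat_mult)
  have pos: "real (n - 1 choose k) > 0" "real (n choose k) > 0" "real n - real k > 0" "real n > 0" "real k > 0"
    using assms by (auto simp: zero_less_binomial_iff)
  have c: "real (n choose k) = real n * real (n - 1 choose k) / (real n - real k)"
    using r2 pos by (simp add: field_simps)
  show ?thesis unfolding r1 c using pos by (simp add: field_simps)
qed

text \<open>The first column of the triangle is \<open>1 / n\<close>, and the recursion takes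
  differences within rows up to \<open>n\<close>, so a common multiple of \<open>1..n\<close> clears
  every denominator. Integrality of a real quotient replaces divisibility because the recursion
  subtracts reciprocals.\<close>

lemma choose_dvd_common_multiple:
  assumes "\<And>j. 1 \<le> j \<Longrightarrow> j \<le> n \<Longrightarrow> j dvd L"
  shows "1 \<le> k \<Longrightarrow> k \<le> n \<Longrightarrow> real L / (real k * real (n choose k)) \<in> \<int>"
  using assms
proof (induction k arbitrary: n)
  case (Suc k)
  show ?case
  proof (cases "k = 0")
    case True
    with Suc have "n dvd L" by auto
    then obtain c where "L = n * c" by (auto simp: dvd_def)
    then show ?thesis using True by auto
  next
    case False
    have "real L / (real (Suc k) * real (n choose Suc k)) = real L / (real k * real (n - 1 choose k)) - real L / (real k * real (n choose k))"
      using arg_cong[OF leibniz_triangle[of k n], of "\<lambda>x. real L * x"] False Suc.prems by (simp add: right_diff_distrib)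
    also have "\<dots> \<in> \<int>" using Suc False by (intro Ints_diff Suc.IH) auto
    finally show ?thesis .
  qed
qed simp

text \<open>Each prime power in the least common multiple of \<open>1..2k\<close> is at most
  \<open>2 * k\<close>, while the whole is a multiple of \<open>k * (2k choose k)\<close>, which is
  at least \<open>4^k / 2\<close>.\<close>

lemma prime_count_lower:
  assumes k: "k \<ge> 1"
  shows "4 ^ k / 2 \<le> real (2 * k) ^ card {p::nat. prime p \<and> p \<le> 2 * k}"
proof -
  let ?P = "{p::nat. prime p \<and> p \<le> 2 * k}"
  have finP: "finite ?P" by simp
  have "\<forall>p\<in>?P. \<exists>e. p ^ e \<le> 2 * k \<and> 2 * k < p ^ (e + 1)"
  proof
    fix p assume "p \<in> ?P"
    then have "p \<ge> 2" by (auto simp: prime_ge_2_nat)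
    then show "\<exists>e. p ^ e \<le> 2 * k \<and> 2 * k < p ^ (e + 1)" using k by (intro ex_power_ivl1) auto
  qed
  from bchoice[OF this] obtain e where e: "\<And>p. p \<in> ?P \<Longrightarrow> p ^ e p \<le> 2 * k" "\<And>p. p \<in> ?P \<Longrightarrow> 2 * k < p ^ (e p + 1)"
    by blast
  \<comment> \<open>\<open>L\<close> is the least common multiple of \<open>1, \<dots>, 2k\<close>, and so divisible by \<open>k (2k choose k)\<close>.\<close>
  define L where "L = (\<Prod>p\<in>?P. p ^ e p)"
  have L0: "L > 0" unfolding L_def by (intro prod_pos) (auto simp: prime_gt_0_nat)
  have dvd: "j dvd L" if j: "1 \<le> j" "j \<le> 2 * k" for j
  proof -
    have sub: "prime_factors j \<subseteq> ?P" 
    proof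
      fix p assume "p \<in> prime_factors j"
      then have "prime p" "p dvd j" by (auto simp: in_prime_factors_iff)
      then show "p \<in> ?P" using j dvd_imp_le[of p j] by simp
    qed
    have "j = (\<Prod>p\<in>prime_factors j. p ^ multiplicity p j)" using j by (simp add: prime_factorization_nat)
    also have "\<dots> dvd (\<Prod>p\<in>prime_factors j. p ^ e p)"
    proof (rule prod_dvd_prod)
      fix p assume p: "p \<in> prime_factors j"
      then have p2: "p \<ge> 2" by (auto simp: in_prime_factors_iff prime_ge_2_nat)
      have "p ^ multiplicity p j \<le> j" using j by (intro dvd_imp_le multiplicity_dvd) auto
      also have "j < p ^ (e p + 1)" using j e(2)[of p] p sub by auto
      finally have lt: "p ^ multiplicity p j < p ^ (e p + 1)" .
      have "multiplicity p j < e p + 1"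
        by (rule power_less_imp_less_exp[OF _ lt]) (use p2 in simp)
      then show "p ^ multiplicity p j dvd p ^ e p" by (intro le_imp_power_dvd) auto
    qed
    also have "\<dots> dvd L" unfolding L_def by (rule prod_dvd_prod_subset[OF finP sub])
    finally show ?thesis .
  qed
  have "real L / (real k * real (2 * k choose k)) \<in> \<int>"
    by (rule choose_dvd_common_multiple) (use dvd k in auto)
  then obtain z where z: "real L / (real k * real (2 * k choose k)) = of_int z" by (auto elim: Ints_cases)
  have pos: "real k * real (2 * k choose k) > 0" using k by (auto simp: zero_less_binomial_iff)
  have "real_of_int z > 0" unfolding z[symmetric] using pos L0 by (intro divide_pos_pos) auto
  then have "real_of_int z \<ge> 1" by simp
  then have "real k * real (2 * k choose k) \<le> real L" using pos by (simp add: z[symmetric] field_simps)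
  moreover have "4 ^ k / 2 \<le> real k * real (2 * k choose k)"
    using mult_left_mono[OF central_binomial_lower_bound[of k], of "real k"] k by (simp add: field_simps)
  moreover have "L \<le> (\<Prod>p\<in>?P. 2 * k)" unfolding L_def by (intro prod_mono) (use e in auto)
  then have "real L \<le> real (2 * k) ^ card ?P"
    unfolding prod_constant of_nat_power[symmetric] of_nat_le_iff .
  ultimately show ?thesis by linarith
qed

text \<open>With fewer than \<open>K\<close> primes in the window there would be at most
  \<open>2 * K\<close> primes up to \<open>K^2\<close>, and \<open>prime_count_lower\<close> would
  bound roughly \<open>2^(K^2)\<close> by \<open>K^(4 K)\<close>.\<close>

lemma many_primes:
  "\<exists>K0. \<forall>K\<ge>K0. K \<le> card {p::nat. prime p \<and> K < p \<and> p \<le> K\<^sup>2}"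
proof -
  \<comment> \<open>The \<open>- 2\<close> absorbs the division by 2 in \<open>4 ^ k / 2\<close> and
    the rounding in \<open>K^2 div 2\<close>.\<close>
  have "eventually (\<lambda>K::nat. 4 * real K * ln (real K) < ((real K)\<^sup>2 - 2) * ln 2) at_top"
    by real_asymp
  then obtain K1 where K1: "\<And>K. K \<ge> K1 \<Longrightarrow> 4 * real K * ln (real K) < ((real K)\<^sup>2 - 2) * ln 2"
    by (auto simp: eventually_at_top_linorder)
  have "K \<le> card {p::nat. prime p \<and> K < p \<and> p \<le> K\<^sup>2}" if K: "K \<ge> max K1 2" for K
  proof (rule ccontr)
    assume neg: "\<not> ?thesis"
    define k where "k = K\<^sup>2 div 2"
    have K2: "2 * k \<le> K\<^sup>2" "K\<^sup>2 \<le> 2 * k + 1" by (auto simp: k_def)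
    have "2\<^sup>2 \<le> K\<^sup>2" using K by (intro power_mono) auto
    then have k1: "k \<ge> 1" by (simp add: k_def)
    have "{p::nat. prime p \<and> p \<le> 2 * k} \<subseteq> {1..K} \<union> {p. prime p \<and> K < p \<and> p \<le> K\<^sup>2}"
      using K2 by (auto dest: prime_gt_0_nat)
    then have "card {p::nat. prime p \<and> p \<le> 2 * k} \<le> card ({1..K} \<union> {p. prime p \<and> K < p \<and> p \<le> K\<^sup>2})"
      by (intro card_mono) auto
    also have "\<dots> \<le> card {1..K} + card {p. prime p \<and> K < p \<and> p \<le> K\<^sup>2}" by (rule card_Un_le)
    also have "\<dots> \<le> 2 * K" using neg by simp
    finally have c: "card {p::nat. prime p \<and> p \<le> 2 * k} \<le> 2 * K" .
    have "4 ^ k / 2 \<le> real (2 * k) ^ card {p::nat. prime p \<and> p \<le> 2 * k}" by (rule prime_count_lower[OF k1])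
    also have "\<dots> \<le> real (2 * k) ^ (2 * K)" using k1 c by (intro power_increasing) auto
    also have "\<dots> \<le> ((real K)\<^sup>2) ^ (2 * K)" using K2(1) by (intro power_mono) (auto simp flip: of_nat_power)
    finally have "4 ^ k / 2 \<le> ((real K)\<^sup>2) ^ (2 * K)" .
    then have "ln (4 ^ k / 2) \<le> ln (((real K)\<^sup>2) ^ (2 * K))" using K by (subst ln_le_cancel_iff) auto
    also have "\<dots> = 4 * real K * ln (real K)" using K by (simp add: ln_realpow)
    finally have "ln (4 ^ k / 2) < ((real K)\<^sup>2 - 2) * ln 2" using K1[of K] K by simp
    also have "ln (4 ^ k / 2) = (2 * real k - 1) * ln 2"
      using ln_realpow[of 2 2] by (simp add: ln_div ln_realpow left_diff_distrib)
    finally have "2 * real k - 1 < (real K)\<^sup>2 - 2" by simp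
    moreover have "(real K)\<^sup>2 \<le> 2 * real k + 1" using K2(2) by (simp flip: of_nat_power)
    ultimately show False by linarith
  qed
  then show ?thesis by blast
qed

section \<open>Sieving for squares\<close>

text \<open>Unlike the Legendre symbol it is 1 at multiples of \<open>p\<close>, so that a perfect
  square gets the value 1 for every \<open>p\<close>.\<close>

definition square_sign :: "int \<Rightarrow> int \<Rightarrow> real" where
  "square_sign p a = (if \<exists>x. [x\<^sup>2 = a] (mod p) then 1 else - 1)"

lemma square_sign_mod: "q dvd m \<Longrightarrow> square_sign q (a mod m) = square_sign q a"
proof -
  assume "q dvd m"
  then have "[a mod m = a] (mod q)" by (simp add: cong_def mod_mod_cancel)
  then have "[x\<^sup>2 = a mod m] (mod q) \<longleftrightarrow> [x\<^sup>2 = a] (mod q)" for x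
    using cong_trans cong_sym by blast
  then show ?thesis by (simp add: square_sign_def)
qed

lemma square_sign_square: "is_int_square a \<Longrightarrow> square_sign p a = 1"
  unfolding is_int_square_def square_sign_def using cong_refl by metis

lemma abs_square_sign: "\<bar>square_sign p a\<bar> = 1"
  by (simp add: square_sign_def)

lemma square_sign_le: "square_sign p a \<le> 1"
  by (simp add: square_sign_def)

text \<open>The squares of \<open>0..h\<close> represent each square class mod
  \<open>p = 2h+1\<close> once, as equal squares come from \<open>x\<close> and \<open>- x\<close>
  only. So \<open>h + 1\<close> residues count 1 and \<open>h\<close> residues count -1.\<close>

lemma sum_square_sign:
  assumes p: "prime p" and odd: "odd p"
  shows "(\<Sum>a\<in>{0..<p}. square_sign p a) = 1"
proof -
  obtain h where h: "p = 2 * h + 1" using odd by (rule oddE)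
  have p0: "p > 0" using p by (simp add: prime_gt_0_int)
  then have h0: "h \<ge> 0" using h by linarith
  let ?Sq = "{a\<in>{0..<p}. \<exists>x. [x\<^sup>2 = a] (mod p)}"
  have eq: "?Sq = (\<lambda>x. x\<^sup>2 mod p) ` {0..h}"
  proof (intro set_eqI iffI)
    fix a assume "a \<in> ?Sq"
    then obtain x where x: "[x\<^sup>2 = a] (mod p)" and a: "0 \<le> a" "a < p" by auto
    have ax: "a = x\<^sup>2 mod p" using x a by (simp add: cong_def)
    define y where "y = x mod p"
    have y: "0 \<le> y" "y < p" using p0 by (auto simp: y_def)
    have ay: "a = y\<^sup>2 mod p" by (simp add: ax y_def power_mod)
    show "a \<in> (\<lambda>x. x\<^sup>2 mod p) ` {0..h}"
    proof (cases "y \<le> h")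
      case True then show ?thesis using ay y by auto
    next
      case False
      have "(p - y)\<^sup>2 = y\<^sup>2 + p * (p - 2 * y)" by (simp add: power2_eq_square algebra_simps)
      then have "a = (p - y)\<^sup>2 mod p" using ay by simp
      moreover have "p - y \<in> {0..h}" using False h y by auto
      ultimately show ?thesis by blast
    qed
  next
    fix a assume "a \<in> (\<lambda>x. x\<^sup>2 mod p) ` {0..h}"
    then show "a \<in> ?Sq" using p0 by (auto simp: cong_def)
  qed
  have inj: "inj_on (\<lambda>x. x\<^sup>2 mod p) {0..h}"
  proof (rule inj_onI)
    fix x y assume xy: "x \<in> {0..h}" "y \<in> {0..h}" and e: "x\<^sup>2 mod p = y\<^sup>2 mod p"
    have "p dvd x\<^sup>2 - y\<^sup>2" using e by (simp add: mod_eq_dvd_iff)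
    also have "x\<^sup>2 - y\<^sup>2 = (x - y) * (x + y)" by (simp add: power2_eq_square algebra_simps)
    finally consider "p dvd x - y" | "p dvd x + y" using p by (auto simp: prime_dvd_mult_iff)
    then show "x = y"
    proof cases
      case 1
      then have "x - y = 0" using xy h dvd_imp_le_int[of "x - y" p] by fastforce
      then show ?thesis by simp
    next
      case 2
      then have "x + y = 0" using xy h zdvd_imp_le[of p "x + y"] by fastforce
      then show ?thesis using xy by auto
    qed
  qed
  have card: "card ?Sq = nat (h + 1)" unfolding eq card_image[OF inj] by simp
  have "(\<Sum>a\<in>{0..<p}. square_sign p a) = (\<Sum>a\<in>{0..<p}. 2 * (if \<exists>x. [x\<^sup>2 = a] (mod p) then 1 else 0) - 1)"
    by (intro sum.cong) (auto simp: square_sign_def)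
  also have "\<dots> = 2 * real (card ?Sq) - real_of_int p"
    using p0 by (simp add: sum_subtractf sum_distrib_left[symmetric] sum.If_cases Int_def)
  also have "\<dots> = 1" unfolding card using h h0 by simp
  finally show ?thesis .
qed

lemma bij_affine_mod:
  assumes p: "prime p" and b: "\<not> p dvd b"
  shows "bij_betw (\<lambda>t. (a + t * b) mod p) {0..<p} {0..<p :: int}"
proof -
  have p0: "p > 0" using p by (simp add: prime_gt_0_int)
  have "inj_on (\<lambda>t. (a + t * b) mod p) {0..<p}"
  proof (rule inj_onI)
    fix s t assume st: "s \<in> {0..<p}" "t \<in> {0..<p}" and "(a + s * b) mod p = (a + t * b) mod p"
    then have "p dvd (s - t) * b" by (simp add: mod_eq_dvd_iff algebra_simps)
    then have "p dvd s - t" using p b by (simp add: prime_dvd_mult_iff)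
    then have "s mod p = t mod p" by (simp add: mod_eq_dvd_iff)
    then show "s = t" using st by simp
  qed
  moreover have "(\<lambda>t. (a + t * b) mod p) ` {0..<p} \<subseteq> {0..<p}" using p0 by auto
  ultimately show ?thesis by (simp add: bij_betw_def endo_inj_surj)
qed

lemma sum_square_sign_affine:
  assumes p: "prime p" "odd p" and b: "\<not> p dvd b"
  shows "(\<Sum>t\<in>{0..<p}. square_sign p (a + t * b)) = 1"
  using sum.reindex_bij_betw[OF bij_affine_mod[OF p(1) b, of a], of "square_sign p"] sum_square_sign[OF p]
  by (simp add: square_sign_mod)

lemma sum_dvd_affine:
  fixes p a b :: int
  assumes p: "prime p" and b: "\<not> p dvd b"
  shows "(\<Sum>t\<in>{0..<p}. if p dvd a + t * b then 1 else 0 :: real) = 1"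
proof -
  have p0: "p > 0" using p by (simp add: prime_gt_0_int)
  have "(\<Sum>t\<in>{0..<p}. if p dvd a + t * b then 1 else 0 :: real) = (\<Sum>t\<in>{0..<p}. if (a + t * b) mod p = 0 then 1 else 0)"
    by (simp add: dvd_eq_mod_eq_0)
  also have "\<dots> = (\<Sum>c\<in>{0..<p}. if c = 0 then 1 else 0)"
    by (rule sum.reindex_bij_betw[OF bij_affine_mod[OF p b], where g = "\<lambda>c. if c = 0 then 1 else 0"])
  also have "\<dots> = 1" using p0 by simp
  finally show ?thesis .
qed

section \<open>Correlations of square signs over the finite groups, and the sieve\<close>

context sl_generators
begin

text \<open>Left multiplication preserves sums over the group, so \<open>F\<close> can be averaged
  over a family of row operations before it is bounded. The increment \<open>c\<close> will be 1 or
  the second prime.\<close>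

lemma row_translation:
  fixes F :: "int^'n^'n \<Rightarrow> real"
  assumes F: "mod_periodic m F" and "k \<noteq> l" and p: "p > 0"
    and le: "\<And>A. A \<in> SL_mod m \<Longrightarrow> (\<Sum>t\<in>{0..<p}. F (elem k l (c * t) ** A)) \<le> G A"
  shows "of_int p * (\<Sum>A\<in>SL_mod m. F A) \<le> (\<Sum>A\<in>SL_mod m. G A)"
proof -
  have "of_int p * (\<Sum>A\<in>SL_mod m. F A) = (\<Sum>t\<in>{0..<p}. \<Sum>A\<in>SL_mod m. F (elem k l (c * t) ** A))"
    using p by (simp add: sum_mult_left[OF F elem_in_SL[OF \<open>k \<noteq> l\<close>]])
  also have "\<dots> = (\<Sum>A\<in>SL_mod m. \<Sum>t\<in>{0..<p}. F (elem k l (c * t) ** A))" by (rule sum.swap)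
  also have "\<dots> \<le> (\<Sum>A\<in>SL_mod m. G A)" by (intro sum_mono le)
  finally show ?thesis .
qed

text \<open>
  Some entry of column \<open>j\<close>, say in row \<open>l\<close>, is a unit mod \<open>p\<close>. If it is not the \<open>k\<close>-th one, then adding
  multiples of row \<open>l\<close> to row \<open>k\<close> makes the \<open>(k,j)\<close> entry uniform mod \<open>p\<close>.
\<close>
lemma sum_dvd_entry:
  assumes p: "prime p" and pm: "p dvd m" and m: "m > 0"
  shows "of_int p * (\<Sum>A\<in>SL_mod m. if p dvd A $ k $ (j::'n) then 1 else 0)
    \<le> real (CARD('n) - 1) * real (card (SL_mod m :: (int^'n^'n) set))"
proof -
  let ?X = "SL_mod m :: (int^'n^'n) set"
  have p0: "p > 0" using p by (simp add: prime_gt_0_int)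
  define H :: "'n \<Rightarrow> int^'n^'n \<Rightarrow> real" where
    "H l A = (if p dvd A $ k $ j \<and> \<not> p dvd A $ l $ j then 1 else 0)" for l A
  have dvd_mod: "p dvd x mod m \<longleftrightarrow> p dvd x" for x using pm by (rule dvd_mod_iff)
  have H: "mod_periodic m (H l)" for l by (simp add: mod_periodic_def H_def dvd_mod)
  have one: "of_int p * (\<Sum>A\<in>?X. H l A) \<le> real (card ?X)" if "l \<noteq> k" for l
  proof -
    have "of_int p * (\<Sum>A\<in>?X. H l A) \<le> (\<Sum>A\<in>?X. 1)"
    proof (rule row_translation[OF H, where k = k and l = l and c = 1])
      fix A :: "int^'n^'n"
      show "(\<Sum>t\<in>{0..<p}. H l (elem k l (1 * t) ** A)) \<le> 1"
      proof (cases "p dvd A $ l $ j")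
        case True
        then show ?thesis using that by (simp add: H_def elem_mult_nth)
      next
        case False
        then show ?thesis using that sum_dvd_affine[OF p False, of "A $ k $ j"] by (simp add: H_def elem_mult_nth)
      qed
    qed (use that p0 in auto)
    then show ?thesis by simp
  qed
  have "(if p dvd A $ k $ j then 1 else 0) \<le> (\<Sum>l\<in>UNIV - {k}. H l A)" if A: "A \<in> ?X" for A
  proof (cases "p dvd A $ k $ j")
    case True
    obtain B where B: "det B = 1" "A = mmod m B" using A by (auto simp: SL_mod_def SL_int_def)
    have "[det B = 1] (mod p)" by (simp add: B)
    then obtain l where l: "\<not> p dvd B $ l $ j" using column_not_zero_mod[OF p, of B j] by blast
    then have l': "\<not> p dvd A $ l $ j" by (simp add: B dvd_mod)
    then have "l \<noteq> k" using True by auto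
    have "H l A \<le> (\<Sum>l\<in>UNIV - {k}. H l A)"
      by (rule member_le_sum) (use \<open>l \<noteq> k\<close> in \<open>auto simp: H_def\<close>)
    then show ?thesis using True l' by (simp add: H_def)
  next
    case False
    then show ?thesis by (simp add: H_def)
  qed
  then have "(\<Sum>A\<in>?X. if p dvd A $ k $ j then 1 else 0) \<le> (\<Sum>A\<in>?X. \<Sum>l\<in>UNIV - {k}. H l A)"
    by (rule sum_mono)
  also have "\<dots> = (\<Sum>l\<in>UNIV - {k}. \<Sum>A\<in>?X. H l A)" by (rule sum.swap)
  finally have "of_int p * (\<Sum>A\<in>?X. if p dvd A $ k $ j then 1 else 0) \<le> of_int p * (\<Sum>l\<in>UNIV - {k}. \<Sum>A\<in>?X. H l A)"
    using p0 by (intro mult_left_mono) auto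
  also have "\<dots> = (\<Sum>l\<in>UNIV - {k}. of_int p * (\<Sum>A\<in>?X. H l A))" by (rule sum_distrib_left)
  also have "\<dots> \<le> (\<Sum>l\<in>UNIV - {k}. real (card ?X))" by (intro sum_mono one) auto
  finally show ?thesis by (simp add: card_Diff_subset)
qed

text \<open>Adding multiples of \<open>q\<close> times another row randomises the entry mod \<open>p\<close> without changing it mod \<open>q\<close>.\<close>
lemma sum_square_sign_pair:
  assumes p: "prime p" "odd p" and q: "prime q" "p \<noteq> q"
  shows "of_int p * (\<Sum>A\<in>SL_mod (p * q). square_sign p (A $ i $ j) * square_sign q (A $ i $ (j::'n)))
    \<le> real CARD('n) * real (card (SL_mod (p * q) :: (int^'n^'n) set))"
proof -
  let ?X = "SL_mod (p * q) :: (int^'n^'n) set"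
  have p0: "p > 0" "p * q > 0" using p q by (simp_all add: prime_gt_0_int)
  have pq: "\<not> p dvd q" using p q by (metis primes_dvd_imp_eq)
  obtain k where k: "k \<noteq> i" using three_indices[OF dim3] .
  let ?F = "\<lambda>A :: int^'n^'n. square_sign p (A $ i $ j) * square_sign q (A $ i $ j)"
  have F: "mod_periodic (p * q) ?F"
    by (simp add: mod_periodic_def square_sign_mod)
  \<comment> \<open>If \<open>p\<close> divides the entry \<open>(k,j)\<close>, the row operations
    fix the entry \<open>(i,j)\<close> mod \<open>p\<close>, and the trivial bound \<open>p\<close>
    is charged to the indicator; otherwise the sum over \<open>t\<close> is 1 up to sign.\<close>
  have "of_int p * (\<Sum>A\<in>?X. ?F A) \<le> (\<Sum>A\<in>?X. 1 + of_int p * (if p dvd A $ k $ j then 1 else 0))"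
  proof (rule row_translation[OF F, where k = i and l = k and c = q])
    fix A :: "int^'n^'n"
    have c: "square_sign q (A $ i $ j + t * (q * A $ k $ j)) = square_sign q (A $ i $ j)" for t
      using square_sign_mod[of q q "A $ i $ j + q * (t * A $ k $ j)"] square_sign_mod[of q q "A $ i $ j"]
      by (simp add: mult.left_commute)
    have e: "(\<Sum>t\<in>{0..<p}. ?F (elem i k (q * t) ** A))
      = square_sign q (A $ i $ j) * (\<Sum>t\<in>{0..<p}. square_sign p (A $ i $ j + t * (q * A $ k $ j)))"
      by (simp add: elem_mult_nth c sum_distrib_left mult_ac)
    show "(\<Sum>t\<in>{0..<p}. ?F (elem i k (q * t) ** A)) \<le> 1 + of_int p * (if p dvd A $ k $ j then 1 else 0)"
    proof (cases "p dvd A $ k $ j")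
      case True
      have "(\<Sum>t\<in>{0..<p}. ?F (elem i k (q * t) ** A)) \<le> (\<Sum>t\<in>{0..<p}. 1)"
        by (intro sum_mono) (auto simp: square_sign_def)
      then show ?thesis using True p0 by simp
    next
      case False
      then have "\<not> p dvd q * A $ k $ j" using p(1) pq by (simp add: prime_dvd_mult_iff)
      then show ?thesis unfolding e using False square_sign_le by (simp add: sum_square_sign_affine[OF p])
    qed
  qed (use k p0 in auto)
  also have "\<dots> = real (card ?X) + of_int p * (\<Sum>A\<in>?X. if p dvd A $ k $ j then 1 else 0)"
    by (simp add: sum.distrib sum_distrib_left)
  also have "\<dots> \<le> real (card ?X) + real (CARD('n) - 1) * real (card ?X)"
    by (intro add_left_mono sum_dvd_entry p(1) p0) auto
  also have "\<dots> = real CARD('n) * real (card ?X)"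
    using dim3 by (simp add: of_nat_diff algebra_simps)
  finally show ?thesis .
qed

text \<open>On a bad word every sign is 1, so the sum of the signs is \<open>card P\<close>, and the
  second moment bounds the number of such words. The diagonal adds
  \<open>1 / card P <= 1 / K\<close> to the off-diagonal \<open>CARD('n) / K\<close>, hence
  \<open>CARD('n) + 1\<close>.\<close>

lemma square_entry_bound:
  obtains r where "0 < r" "r < 1"
    "\<And>N K P i j. K \<ge> 2 \<Longrightarrow> P \<subseteq> {p. prime p \<and> int K < p \<and> p \<le> (int K)\<^sup>2} \<Longrightarrow> K \<le> card P \<Longrightarrow>
      real (card {w \<in> words N. is_int_square (word_prod w $ i $ j)})
      \<le> real (card S) ^ N * (real (CARD('n) + 1) / real K + 2 * r ^ N * real K ^ (2 * (CARD('n) * CARD('n))))"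
proof (rule equidistribution)
  fix r :: real
  assume r: "0 < r" "r < 1" and equi:
    "\<And>p q N F. prime p \<Longrightarrow> prime q \<Longrightarrow> p \<noteq> q \<Longrightarrow> odd (p * q) \<Longrightarrow> mod_periodic (p * q) F \<Longrightarrow> (\<And>A. \<bar>F A\<bar> \<le> 1) \<Longrightarrow>
      (\<Sum>w\<in>words N. F (word_prod w)) \<le> real (card S) ^ N *
        ((\<Sum>A\<in>SL_mod (p * q). F A) / real (card (SL_mod (p * q) :: (int^'n^'n) set))
          + 2 * r ^ N * sqrt (of_int (p * q) ^ (CARD('n) * CARD('n))))"
  show thesis
  proof (rule that[OF r])
    fix N K :: nat and P :: "int set" and i j :: 'n
    assume K: "K \<ge> 2" and P: "P \<subseteq> {p. prime p \<and> int K < p \<and> p \<le> (int K)\<^sup>2}" and cP: "K \<le> card P"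
    let ?d = "CARD('n) * CARD('n)" and ?s = "real (card S) ^ N"
    let ?bad = "{w \<in> words N. is_int_square (word_prod w $ i $ j)}"
    \<comment> \<open>The first summand bounds the mean of a product of two signs, using
      \<open>p > K\<close>; the second is the equidistribution error, where
      \<open>p * q <= K^4\<close> makes the square root at most \<open>K^(2 n^2)\<close>.\<close>
    define \<epsilon> where "\<epsilon> = real CARD('n) / real K + 2 * r ^ N * real K ^ (2 * ?d)"
    have finP: "finite P" by (rule card_ge_0_finite) (use cP K in simp)
    have \<epsilon>0: "\<epsilon> \<ge> 0" using r by (auto simp: \<epsilon>_def)
    let ?h = "\<lambda>p w. square_sign p (word_prod w $ i $ j)"
    have off: "(\<Sum>w\<in>words N. ?h p w * ?h q w) \<le> ?s * \<epsilon>" if pq: "p \<in> P" "q \<in> P" "p \<noteq> q" for p q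
    proof -
      let ?F = "\<lambda>A :: int^'n^'n. square_sign p (A $ i $ j) * square_sign q (A $ i $ j)"
      let ?X = "SL_mod (p * q) :: (int^'n^'n) set"
      have p: "prime p" "int K < p" "p \<le> (int K)\<^sup>2" and q: "prime q" "int K < q" "q \<le> (int K)\<^sup>2" using pq P by auto
      have op: "odd p" "odd q" using p q K by (auto simp: prime_odd_int)
      have pos: "p * q > 0" using p q by (simp add: prime_gt_0_int)
      have "card ?X > 0" using SL_mod_one finite_SL_mod[OF pos] by (auto simp: card_gt_0_iff)
      moreover have "of_int p * (\<Sum>A\<in>?X. ?F A) \<le> real CARD('n) * real (card ?X)"
        by (rule sum_square_sign_pair[OF p(1) op(1) q(1) pq(3)])
      moreover have "real_of_int p > 0" using p by (simp add: prime_gt_0_int)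
      ultimately have "(\<Sum>A\<in>?X. ?F A) / real (card ?X) \<le> real CARD('n) / of_int p"
        by (simp add: field_simps)
      also have "\<dots> \<le> real CARD('n) / real K" using p K by (intro divide_left_mono) auto
      finally have mean: "(\<Sum>A\<in>?X. ?F A) / real (card ?X) \<le> real CARD('n) / real K" .
      have "real_of_int (p * q) \<le> real_of_int ((int K)\<^sup>2 * (int K)\<^sup>2)"
        using p q by (intro of_int_le_iff[THEN iffD2] mult_mono) (auto simp: prime_ge_0_int)
      also have "\<dots> = (real K)\<^sup>2 * (real K)\<^sup>2" by simp
      finally have "real_of_int (p * q) ^ ?d \<le> ((real K)\<^sup>2 * (real K)\<^sup>2) ^ ?d"
        using pos by (intro power_mono) linarith+
      also have "\<dots> = (real K ^ (2 * ?d))\<^sup>2"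
        by (simp add: power_mult_distrib power_mult[symmetric] power_add[symmetric] mult.commute)
      finally have rt: "sqrt (real_of_int (p * q) ^ ?d) \<le> real K ^ (2 * ?d)"
        by (intro real_le_lsqrt) auto
      have F: "mod_periodic (p * q) ?F" by (simp add: mod_periodic_def square_sign_mod)
      have "(\<Sum>w\<in>words N. ?h p w * ?h q w) \<le> ?s * ((\<Sum>A\<in>?X. ?F A) / real (card ?X) + 2 * r ^ N * sqrt (of_int (p * q) ^ ?d))"
        by (rule equi[OF p(1) q(1) pq(3) _ F]) (use op in \<open>auto simp: abs_mult abs_square_sign\<close>)
      also have "\<dots> \<le> ?s * \<epsilon>" unfolding \<epsilon>_def
        using mean rt r by (intro mult_left_mono add_mono) auto
      finally show ?thesis .
    qed
    have "real (card ?bad) * (real (card P))\<^sup>2 = (\<Sum>w\<in>?bad. (\<Sum>p\<in>P. ?h p w)\<^sup>2)"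
      by (simp add: square_sign_square)
    also have "\<dots> \<le> (\<Sum>w\<in>words N. (\<Sum>p\<in>P. ?h p w)\<^sup>2)"
      by (rule sum_mono2) (auto simp: finite_words)
    also have "\<dots> = (\<Sum>p\<in>P. \<Sum>q\<in>P. \<Sum>w\<in>words N. ?h p w * ?h q w)"
      unfolding power2_eq_square sum_product by (rule sum_rotate3)
    also have "\<dots> \<le> (\<Sum>p\<in>P. \<Sum>q\<in>P. (if p = q then ?s else 0) + ?s * \<epsilon>)"
    proof (intro sum_mono)
      fix p q assume "p \<in> P" "q \<in> P"
      show "(\<Sum>w\<in>words N. ?h p w * ?h q w) \<le> (if p = q then ?s else 0) + ?s * \<epsilon>"
      proof (cases "p = q")
        case True
        have "?h q w * ?h q w = 1" for w by (simp add: square_sign_def)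
        then have "(\<Sum>w\<in>words N. ?h p w * ?h q w) = ?s" using True by (simp add: card_words)
        then show ?thesis using True \<epsilon>0 by simp
      qed (use off \<open>p \<in> P\<close> \<open>q \<in> P\<close> in auto)
    qed
    also have "\<dots> = real (card P) * ?s + (real (card P))\<^sup>2 * (?s * \<epsilon>)"
      using finP by (simp add: sum.distrib power2_eq_square algebra_simps)
    also have "\<dots> = (real (card P))\<^sup>2 * (?s * (1 / real (card P) + \<epsilon>))"
      using cP K by (simp add: field_simps power2_eq_square)
    finally have "(real (card P))\<^sup>2 * real (card ?bad) \<le> (real (card P))\<^sup>2 * (?s * (1 / real (card P) + \<epsilon>))"
      by (simp add: mult.commute)
    moreover have "(real (card P))\<^sup>2 > 0" using cP K by simp
    ultimately have "real (card ?bad) \<le> ?s * (1 / real (card P) + \<epsilon>)" by simp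
    also have "\<dots> \<le> ?s * (1 / real K + \<epsilon>)"
      using cP K by (intro mult_left_mono add_right_mono divide_left_mono) auto
    also have "1 / real K + \<epsilon> = real (CARD('n) + 1) / real K + 2 * r ^ N * real K ^ (2 * ?d)"
      by (simp add: \<epsilon>_def add_divide_distrib)
    finally show "real (card ?bad) \<le> ?s * (real (CARD('n) + 1) / real K + 2 * r ^ N * real K ^ (2 * ?d))" .
  qed
qed

theorem square_entries_exponentially_rare:
  "\<exists>\<mu> C. 0 < \<mu> \<and> \<mu> < 1 \<and> (\<forall>N. real (card {w \<in> words N. \<exists>i j. is_int_square (word_prod w $ i $ j)})
    \<le> C * (real (card S) ^ N * \<mu> ^ N))"
proof (rule square_entry_bound)
  fix r :: real
  assume r: "0 < r" "r < 1" and bound: "\<And>N K P i j. K \<ge> 2 \<Longrightarrow> P \<subseteq> {p. prime p \<and> int K < p \<and> p \<le> (int K)\<^sup>2} \<Longrightarrow> K \<le> card P \<Longrightarrow>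
      real (card {w \<in> words N. is_int_square (word_prod w $ i $ j)})
      \<le> real (card S) ^ N * (real (CARD('n) + 1) / real K + 2 * r ^ N * real K ^ (2 * (CARD('n) * CARD('n))))"
  obtain K0 where K0: "\<And>K. K \<ge> K0 \<Longrightarrow> K \<le> card {p::nat. prime p \<and> K < p \<and> p \<le> K\<^sup>2}" using many_primes by blast
  define K1 where "K1 = K0 + 2"
  let ?d = "CARD('n) * CARD('n)"
  define e where "e = 2 * ?d"
  have e0: "real e > 0" by (simp add: e_def)
  \<comment> \<open>Chosen to give \<open>\<theta>^e * r = sqrt r\<close>: for \<open>K\<close> of
    size \<open>\<theta>^N\<close> the error \<open>r^N * K^e\<close> still decays at rate
    \<open>sqrt r\<close>, while \<open>1 / K\<close> decays at rate
    \<open>1 / \<theta>\<close>.\<close>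
  define \<theta> where "\<theta> = r powr (- 1 / (2 * real e))"
  have \<theta>0: "\<theta> > 0" using r by (simp add: \<theta>_def)
  have \<theta>e: "\<theta> ^ e * r = sqrt r"
  proof -
    have "\<theta> ^ e = \<theta> powr real e" using \<theta>0 by (simp add: powr_realpow)
    also have "\<dots> = r powr (- 1 / 2)" using e0 by (simp add: \<theta>_def powr_powr)
    finally have "\<theta> ^ e * r = r powr (- 1 / 2) * r powr 1" using r by simp
    also have "\<dots> = r powr (- 1 / 2 + 1)" by (rule powr_add[symmetric])
    also have "- 1 / 2 + 1 = (1 / 2 :: real)" by simp
    finally show ?thesis using r by (simp add: powr_half_sqrt)
  qed
  have \<theta>1: "\<theta> > 1"
  proof -
    have "r powr 0 < r powr (- 1 / (2 * real e))" using r e0 by (intro powr_less_mono') auto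
    then show ?thesis using r by (simp add: \<theta>_def)
  qed
  define \<mu> where "\<mu> = max (1 / \<theta>) (sqrt r)"
  define C1 where "C1 = real (CARD('n) + 1) + 2 * real (K1 + 1) ^ e"
  have entry: "real (card {w \<in> words N. is_int_square (word_prod w $ i $ j)}) \<le> C1 * (real (card S) ^ N * \<mu> ^ N)" for N and i j :: 'n
  proof -
    \<comment> \<open>\<open>K1\<close> keeps \<open>K\<close> at least \<open>K0\<close> and 2 for
      every \<open>N\<close>, and outweighs the loss in the floor, so that
      \<open>\<theta>^N <= K\<close>.\<close>
    define K where "K = K1 + nat \<lfloor>\<theta> ^ N\<rfloor>"
    have \<theta>N: "\<theta> ^ N \<ge> 1" using \<theta>1 by (simp add: one_le_power)
    have Klow: "\<theta> ^ N \<le> real K" unfolding K_def K1_def using \<theta>N by linarith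
    have "real K \<le> real K1 + \<theta> ^ N" unfolding K_def using \<theta>N by simp
    also have "\<dots> \<le> real K1 * \<theta> ^ N + \<theta> ^ N" using \<theta>N mult_left_mono[OF \<theta>N, of "real K1"] by simp
    also have "\<dots> = real (K1 + 1) * \<theta> ^ N" by (simp add: algebra_simps)
    finally have Kup: "real K \<le> real (K1 + 1) * \<theta> ^ N" .
    define P where "P = int ` {p::nat. prime p \<and> K < p \<and> p \<le> K\<^sup>2}"
    have "card P = card {p::nat. prime p \<and> K < p \<and> p \<le> K\<^sup>2}" unfolding P_def by (rule card_image) simp
    then have cP: "K \<le> card P" using K0[of K] by (simp add: K_def K1_def)
    have sub: "P \<subseteq> {p. prime p \<and> int K < p \<and> p \<le> (int K)\<^sup>2}"
      unfolding P_def by (auto simp flip: of_nat_power)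
    have K2: "K \<ge> 2" by (simp add: K_def K1_def)
    have "real (CARD('n) + 1) / real K \<le> real (CARD('n) + 1) / \<theta> ^ N"
      using Klow \<theta>0 K2 by (intro divide_left_mono mult_pos_pos) auto
    also have "\<dots> = real (CARD('n) + 1) * (1 / \<theta>) ^ N" by (simp add: power_divide)
    also have "\<dots> \<le> real (CARD('n) + 1) * \<mu> ^ N"
      using \<theta>0 by (intro mult_left_mono power_mono) (auto simp: \<mu>_def)
    finally have t1: "real (CARD('n) + 1) / real K \<le> real (CARD('n) + 1) * \<mu> ^ N" .
    have "r ^ N * real K ^ e \<le> r ^ N * (real (K1 + 1) * \<theta> ^ N) ^ e"
      using r Kup by (intro mult_left_mono power_mono) auto
    also have "\<dots> = real (K1 + 1) ^ e * (\<theta> ^ e * r) ^ N"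
      by (simp add: power_mult_distrib power_mult[symmetric] mult_ac)
    also have "\<dots> \<le> real (K1 + 1) ^ e * \<mu> ^ N"
      unfolding \<theta>e using r by (intro mult_left_mono power_mono) (auto simp: \<mu>_def)
    finally have t2: "2 * r ^ N * real K ^ e \<le> 2 * real (K1 + 1) ^ e * \<mu> ^ N" by simp
    have "real (card {w \<in> words N. is_int_square (word_prod w $ i $ j)})
      \<le> real (card S) ^ N * (real (CARD('n) + 1) / real K + 2 * r ^ N * real K ^ e)"
      unfolding e_def by (rule bound[OF K2 sub cP])
    also have "\<dots> \<le> real (card S) ^ N * (real (CARD('n) + 1) * \<mu> ^ N + 2 * real (K1 + 1) ^ e * \<mu> ^ N)"
      by (intro mult_left_mono add_mono t1 t2) auto
    also have "\<dots> = C1 * (real (card S) ^ N * \<mu> ^ N)" by (simp add: C1_def algebra_simps)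
    finally show ?thesis .
  qed
  have "real (card {w \<in> words N. \<exists>i j. is_int_square (word_prod w $ i $ j)}) \<le> real ?d * C1 * (real (card S) ^ N * \<mu> ^ N)" for N
  proof -
    let ?B = "\<lambda>z :: 'n \<times> 'n. {w \<in> words N. is_int_square (word_prod w $ fst z $ snd z)}"
    have "{w \<in> words N. \<exists>i j. is_int_square (word_prod w $ i $ j)} = (\<Union>z\<in>UNIV. ?B z)" by (auto simp: image_iff) blast
    then have "card {w \<in> words N. \<exists>i j. is_int_square (word_prod w $ i $ j)} \<le> (\<Sum>z\<in>UNIV. card (?B z))"
      by (simp add: card_UN_le)
    then have "real (card {w \<in> words N. \<exists>i j. is_int_square (word_prod w $ i $ j)}) \<le> (\<Sum>z\<in>UNIV. real (card (?B z)))"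
      by (simp only: of_nat_le_iff flip: of_nat_sum)
    also have "\<dots> \<le> (\<Sum>z\<in>(UNIV :: ('n \<times> 'n) set). C1 * (real (card S) ^ N * \<mu> ^ N))" by (intro sum_mono entry)
    finally show ?thesis by simp
  qed
  moreover have "0 < \<mu>" "\<mu> < 1" using r \<theta>1 by (auto simp: \<mu>_def less_max_iff_disj)
  ultimately show ?thesis by blast
qed

end

theorem theorem1p3:
  fixes S :: "(int^'n^'n) set"
  assumes "CARD('n) \<ge> 3"
    and "finite S"
    and "S \<subseteq> SL_int"
    and "symmetric_set S"
    and "gen_subgroup S = SL_int"
  shows "\<exists>\<beta>>0. \<exists>C::real. \<forall>N::nat. N \<ge> 1 \<longrightarrow>
           real (card {w. length w = N \<and> set w \<subseteq> S \<and>
                   (\<exists>i j. is_int_square (word_prod w $ i $ j))})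
           \<le> C * real (card S) powr (real N * (1 - \<beta>))"
proof -
  interpret sl_generators S by unfold_locales (rule assms)+
  have bad: "{w. length w = N \<and> set w \<subseteq> S \<and> (\<exists>i j. is_int_square (word_prod w $ i $ j))}
    = {w \<in> words N. \<exists>i j. is_int_square (word_prod w $ i $ j)}" for N
    by (auto simp: words_def)
  show ?thesis unfolding bad
  proof (cases "card S \<le> 1")
    \<comment> \<open>Logarithms to base \<open>card S\<close> need \<open>card S > 1\<close>. Here
      \<open>\<beta> = 1\<close> works: as \<open>N >= 1\<close>, the count is at most
      \<open>card S\<close>, and for empty \<open>S\<close> both sides are 0 because
      \<open>0 powr 0 = 0\<close>.\<close>
    case True
    have "real (card {w \<in> words N. \<exists>i j. is_int_square (word_prod w $ i $ j)}) \<le> 1 * real (card S) powr (real N * (1 - 1))"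
      if "N \<ge> 1" for N
    proof -
      have "card {w \<in> words N. \<exists>i j. is_int_square (word_prod w $ i $ j)} \<le> card S ^ N"
        unfolding card_words[symmetric] by (intro card_mono finite_words) auto
      also have "\<dots> \<le> card S" using True that by (cases "card S = 0") (auto simp: le_Suc_eq)
      finally show ?thesis using True by (cases "card S = 0") auto
    qed
    then show "\<exists>\<beta>>0. \<exists>C. \<forall>N\<ge>1. real (card {w \<in> words N. \<exists>i j. is_int_square (word_prod w $ i $ j)})
        \<le> C * real (card S) powr (real N * (1 - \<beta>))"
      using zero_less_one by blast
  next
    case False
    then have S: "real (card S) > 1" by simp
    obtain \<mu> C where \<mu>: "0 < \<mu>" "\<mu> < 1" and C: "\<And>N. real (card {w \<in> words N. \<exists>i j. is_int_square (word_prod w $ i $ j)})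
        \<le> C * (real (card S) ^ N * \<mu> ^ N)"
      using square_entries_exponentially_rare by blast
    \<comment> \<open>Equivalently, \<open>card S powr (- \<beta>) = \<mu>\<close>.\<close>
    define \<beta> where "\<beta> = - log (real (card S)) \<mu>"
    have "\<beta> > 0" using \<mu> S by (simp add: \<beta>_def)
    have eq: "real (card S) ^ N * \<mu> ^ N = real (card S) powr (real N * (1 - \<beta>))" for N
    proof -
      have "real (card S) powr (real N * (1 - \<beta>)) = (real (card S) powr (1 + log (real (card S)) \<mu>)) powr real N"
        by (simp add: powr_powr \<beta>_def mult.commute)
      also have "\<dots> = (real (card S) * \<mu>) powr real N" using S \<mu> by (simp add: powr_add)
      also have "\<dots> = real (card S) ^ N * \<mu> ^ N" using S \<mu> by (simp add: powr_realpow power_mult_distrib)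
      finally show ?thesis by simp
    qed
    have "real (card {w \<in> words N. \<exists>i j. is_int_square (word_prod w $ i $ j)})
        \<le> C * real (card S) powr (real N * (1 - \<beta>))" for N
      using C[of N] by (simp only: eq)
    with \<open>\<beta> > 0\<close> show "\<exists>\<beta>>0. \<exists>C. \<forall>N\<ge>1. real (card {w \<in> words N. \<exists>i j. is_int_square (word_prod w $ i $ j)})
        \<le> C * real (card S) powr (real N * (1 - \<beta>))"
      by blast
  qed
qed

end
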